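(* Let $D\ge 1$ and $q\ge 0$ be integers. The map $\Psi$, which sends a pair $(G,\Omega)$ to the stacked map $\Psi(G,\Omega)$, is a bijection between (isomorphism classes of) pairs $(G,\Omega)$, where $G$ is a non-necessarily connected bipartite $(D+1)$-edge-colored graph with $q$ marked color-$0$ edges and $\Omega$ is a pairing of its vertices (with at most one marked edge on each cycle alternating color-$0$ edges and pairs of $\Omega$), and (isomorphism classes of) non-necessarily connected stacked maps with colors $\{0,\dots,D\}$ and $q$ marked corners on $q$ distinct color-$0$ vertices. Moreover, for all colors $i<j$ in $\{0,\dots,D\}$, it maps the bicolored cycles of $G$ alternating colors $i$ and $j$ to the faces of the twisted bicolored submap $\Psi(G,\Omega)_\wr^{(ij)}$.
   Context: Colored graphs: finite graphs (multiple edges allowed) with vertices colored black/white, every edge joining a black and a white vertex, every vertex incident to exactly one edge of each color in $\{0,\dots,D\}$. A bicolored cycle $ij$ is a connected component of the subgraph formed by the edges of colors $i$ and $j$. A pairing $\Omega$ is a partition of the vertices into pairs, each consisting of one black and one white vertex (not necessarily adjacent). Isomorphisms preserve vertex colors, edge colors, pairs and marks. For each color $i$ let $\sigma_i$ be the permutation of the set of pairs of $\Omega$ such that $\sigma_i(\pi)=\pi'$ if the color-$i$ edge incident to the black vertex of $\pi$ ends at the white vertex of $\pi'$ (equivalently: orient all edges from black to white and contract each pair; the color-$i$ edges form disjoint directed cycles). Color-$0$ edges thus correspond to consecutive elements along cycles of $\sigma_0$; some color-$0$ edges may be marked, with at most one marked edge per cycle of $\sigma_0$. Stacked maps (colors $\{0,\dots,D\}$):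 objects with white vertices, colored vertices, and colored edges; an edge of color $i$ joins a white vertex to a vertex of color $i$; each white vertex is incident to exactly one edge of each color $0,\dots,D$, with no ordering of these edges; a color-$i$ vertex is incident only to color-$i$ edges, which are cyclically ordered (counterclockwise) around it. A corner is a pair of consecutive edges around a colored vertex. Some corners at color-$0$ vertices may be marked, at most one per vertex. Isomorphisms preserve colors, cyclic orders and marks. $\Psi(G,\Omega)$ has one white vertex per pair of $\Omega$ and, for each color $i$ and each cycle of $\sigma_i$, one color-$i$ vertex joined by color-$i$ edges to the pairs of that cycle, in the cyclic order given by $\sigma_i$. A color-$i$ edge of $G$ corresponds to a corner at a color-$i$ vertex, and a marked color-$0$ edge gives a marked corner. For $i<j$, the bicolored submap $\Gamma^{(ij)}$ of a stacked map $\Gamma$ is obtained by deleting all edges and colored vertices of colors other than $i,j$; since its white vertices have valency two it is an ordinary (non-necessarily connected) combinatorial map. The twisted submap $\Gamma_\wr^{(ij)}$ is obtained from it by adding a twist (face-reversing sign $-$) on every color-$i$ edge, color-$j$ edges being untwisted; equivalently (changing orientation locally at all color-$i$ vertices), its faces are those of the untwisted map obtained from $\Gamma^{(ij)}$ by reversing the cyclic order at every color-$i$ vertex. *)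

theory Defs
  imports
    "HOL-Library.Disjoint_Sets"
    "HOL-Library.Infinite_Typeclass"
    "HOL-Combinatorics.Orbits"
begin

record ('v, 'e) colored_graph =
  blacks :: "'v set"
  whites :: "'v set"
  edges :: "'e set"
  black_end :: "'e \<Rightarrow> 'v"
  white_end :: "'e \<Rightarrow> 'v"
  color :: "'e \<Rightarrow> nat"

definition colored_graph :: "nat \<Rightarrow> ('v, 'e, 'x) colored_graph_scheme \<Rightarrow> bool" where
  "colored_graph D G \<longleftrightarrow>
     finite (blacks G) \<and> finite (whites G) \<and> blacks G \<inter> whites G = {} \<and> finite (edges G) \<and>
     (\<forall>e\<in>edges G. black_end G e \<in> blacks G \<and> white_end G e \<in> whites G \<and> color G e \<le> D) \<and>
     (\<forall>v\<in>blacks G. \<forall>i\<le>D. \<exists>!e. e \<in> edges G \<and> color G e = i \<and> black_end G e = v) \<and>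
     (\<forall>v\<in>whites G. \<forall>i\<le>D. \<exists>!e. e \<in> edges G \<and> color G e = i \<and> white_end G e = v)"

definition bicolored_edges ::
  "('v, 'e, 'x) colored_graph_scheme \<Rightarrow> nat \<Rightarrow> nat \<Rightarrow> 'e set" where
  "bicolored_edges G i j = {e \<in> edges G. color G e = i \<or> color G e = j}"

definition bicolored_adj ::
  "('v, 'e, 'x) colored_graph_scheme \<Rightarrow> nat \<Rightarrow> nat \<Rightarrow> ('v \<times> 'v) set" where
  "bicolored_adj G i j =
     {(u, v). \<exists>e\<in>bicolored_edges G i j. {u, v} = {black_end G e, white_end G e}}"

text \<open>A connected component is given as a subgraph, i.e. by its vertex set and its edge set.\<close>

definition bicolored_component ::
  "('v, 'e, 'x) colored_graph_scheme \<Rightarrow> nat \<Rightarrow> nat \<Rightarrow> 'v \<Rightarrow> 'v set \<times> 'e set" where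
  "bicolored_component G i j u =
     (let K = (bicolored_adj G i j)\<^sup>* `` {u}
      in (K, {e \<in> bicolored_edges G i j. black_end G e \<in> K \<and> white_end G e \<in> K}))"

definition bicolored_cycles ::
  "('v, 'e, 'x) colored_graph_scheme \<Rightarrow> nat \<Rightarrow> nat \<Rightarrow> ('v set \<times> 'e set) set" where
  "bicolored_cycles G i j = bicolored_component G i j ` (blacks G \<union> whites G)"

record ('v, 'e) paired_graph = "('v, 'e) colored_graph" +
  pairing :: "'v set set"
  marked_edges :: "'e set"

definition is_pairing :: "('v, 'e, 'x) colored_graph_scheme \<Rightarrow> 'v set set \<Rightarrow> bool" where
  "is_pairing G \<Omega> \<longleftrightarrow> partition_on (blacks G \<union> whites G) \<Omega> \<and>
     (\<forall>\<pi>\<in>\<Omega>. \<exists>b\<in>blacks G. \<exists>w\<in>whites G. \<pi> = {b, w})"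

definition pair_of :: "('v, 'e) paired_graph \<Rightarrow> 'v \<Rightarrow> 'v set" where
  "pair_of X v = (THE \<pi>. \<pi> \<in> pairing X \<and> v \<in> \<pi>)"

definition sigma :: "('v, 'e) paired_graph \<Rightarrow> nat \<Rightarrow> 'v set \<Rightarrow> 'v set" where
  "sigma X i \<pi> = (THE \<pi>'. \<pi>' \<in> pairing X \<and>
     (\<exists>e\<in>edges X. color X e = i \<and> black_end X e \<in> \<pi> \<and> white_end X e \<in> \<pi>'))"

text \<open>A color-0 edge lies on the cycle of \<open>\<sigma>\<^sub>0\<close> that contains the pair of its black end.\<close>

definition marked_paired_graph :: "nat \<Rightarrow> nat \<Rightarrow> ('v, 'e) paired_graph \<Rightarrow> bool" where
  "marked_paired_graph D q X \<longleftrightarrow>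
     colored_graph D X \<and> is_pairing X (pairing X) \<and>
     marked_edges X \<subseteq> {e \<in> edges X. color X e = 0} \<and>
     inj_on (\<lambda>e. orbit (sigma X 0) (pair_of X (black_end X e))) (marked_edges X) \<and>
     card (marked_edges X) = q"

definition paired_graph_iso ::
  "('v, 'e) paired_graph \<Rightarrow> ('w, 'f) paired_graph \<Rightarrow> bool" where
  "paired_graph_iso X Y \<longleftrightarrow> (\<exists>fv fe.
     bij_betw fv (blacks X \<union> whites X) (blacks Y \<union> whites Y) \<and>
     fv ` blacks X = blacks Y \<and> fv ` whites X = whites Y \<and>
     bij_betw fe (edges X) (edges Y) \<and>
     (\<forall>e\<in>edges X. black_end Y (fe e) = fv (black_end X e) \<and>
        white_end Y (fe e) = fv (white_end X e) \<and> color Y (fe e) = color X e) \<and>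
     (\<lambda>\<pi>. fv ` \<pi>) ` pairing X = pairing Y \<and>
     fe ` marked_edges X = marked_edges Y)"

text \<open>
  The function \<open>next_edge\<close> sends an edge to its counterclockwise successor around its colored
  vertex; a corner is the ordered pair of an edge and its successor, so that a vertex of
  valency one has one corner and a vertex of valency two has two of them.
\<close>

record ('w, 'c, 'd) stacked_map =
  white_verts :: "'w set"
  col_verts :: "'c set"
  map_edges :: "'d set"
  vert_color :: "'c \<Rightarrow> nat"
  edge_color :: "'d \<Rightarrow> nat"
  edge_white :: "'d \<Rightarrow> 'w"
  edge_col :: "'d \<Rightarrow> 'c"
  next_edge :: "'d \<Rightarrow> 'd"
  marked_corners :: "('d \<times> 'd) set"

text \<open>
  As \<open>cyclic_on f S\<close> forces \<open>S\<close> to be nonempty, there are no isolated colored vertices.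
\<close>

definition stacked_map :: "nat \<Rightarrow> nat \<Rightarrow> ('w, 'c, 'd) stacked_map \<Rightarrow> bool" where
  "stacked_map D q \<Gamma> \<longleftrightarrow>
     finite (white_verts \<Gamma>) \<and> finite (col_verts \<Gamma>) \<and> finite (map_edges \<Gamma>) \<and>
     (\<forall>c\<in>col_verts \<Gamma>. vert_color \<Gamma> c \<le> D) \<and>
     (\<forall>e\<in>map_edges \<Gamma>. edge_white \<Gamma> e \<in> white_verts \<Gamma> \<and> edge_col \<Gamma> e \<in> col_verts \<Gamma> \<and>
        edge_color \<Gamma> e = vert_color \<Gamma> (edge_col \<Gamma> e)) \<and>
     (\<forall>w\<in>white_verts \<Gamma>. \<forall>i\<le>D.
        \<exists>!e. e \<in> map_edges \<Gamma> \<and> edge_color \<Gamma> e = i \<and> edge_white \<Gamma> e = w) \<and>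
     (\<forall>c\<in>col_verts \<Gamma>. cyclic_on (next_edge \<Gamma>) {e \<in> map_edges \<Gamma>. edge_col \<Gamma> e = c}) \<and>
     marked_corners \<Gamma> \<subseteq> {(e, next_edge \<Gamma> e) | e. e \<in> map_edges \<Gamma> \<and> edge_color \<Gamma> e = 0} \<and>
     inj_on (\<lambda>(e, f). edge_col \<Gamma> e) (marked_corners \<Gamma>) \<and>
     card (marked_corners \<Gamma>) = q"

definition stacked_map_iso ::
  "('w, 'c, 'd) stacked_map \<Rightarrow> ('w1, 'c1, 'd1) stacked_map \<Rightarrow> bool" where
  "stacked_map_iso \<Gamma> \<Delta> \<longleftrightarrow> (\<exists>fw fc fe.
     bij_betw fw (white_verts \<Gamma>) (white_verts \<Delta>) \<and>
     bij_betw fc (col_verts \<Gamma>) (col_verts \<Delta>) \<and>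
     bij_betw fe (map_edges \<Gamma>) (map_edges \<Delta>) \<and>
     (\<forall>c\<in>col_verts \<Gamma>. vert_color \<Delta> (fc c) = vert_color \<Gamma> c) \<and>
     (\<forall>e\<in>map_edges \<Gamma>. edge_color \<Delta> (fe e) = edge_color \<Gamma> e \<and>
        edge_white \<Delta> (fe e) = fw (edge_white \<Gamma> e) \<and>
        edge_col \<Delta> (fe e) = fc (edge_col \<Gamma> e) \<and>
        next_edge \<Delta> (fe e) = fe (next_edge \<Gamma> e)) \<and>
     map_prod fe fe ` marked_corners \<Gamma> = marked_corners \<Delta>)"

text \<open>The corner \<open>((i, \<pi>), (i, \<sigma>\<^sub>i \<pi>))\<close> corresponding to a color-\<open>i\<close> edge of the graph.\<close>

definition corner_of ::
  "('v, 'e) paired_graph \<Rightarrow> 'e \<Rightarrow> (nat \<times> 'v set) \<times> (nat \<times> 'v set)" where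
  "corner_of X e =
     ((color X e, pair_of X (black_end X e)), (color X e, pair_of X (white_end X e)))"

definition Psi ::
  "nat \<Rightarrow> ('v, 'e) paired_graph \<Rightarrow> ('v set, nat \<times> 'v set set, nat \<times> 'v set) stacked_map" where
  "Psi D X =
     \<lparr> white_verts = pairing X,
       col_verts = {(i, orbit (sigma X i) \<pi>) | i \<pi>. i \<le> D \<and> \<pi> \<in> pairing X},
       map_edges = {..D} \<times> pairing X,
       vert_color = fst,
       edge_color = fst,
       edge_white = snd,
       edge_col = (\<lambda>(i, \<pi>). (i, orbit (sigma X i) \<pi>)),
       next_edge = (\<lambda>(i, \<pi>). (i, sigma X i \<pi>)),
       marked_corners = corner_of X ` marked_edges X \<rparr>"

text \<open>
  The objects being finite, every isomorphism class has representatives labelled by elements of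
  any given infinite types. As \<open>Psi D X\<close> has label types of its own, the class of
  \<open>Psi D X\<close> is formed by the maps on the given label types that are isomorphic to it.
\<close>

definition paired_graph_classes :: "nat \<Rightarrow> nat \<Rightarrow> ('v, 'e) paired_graph set set" where
  "paired_graph_classes D q = {X. marked_paired_graph D q X} //
     {(X, Y). marked_paired_graph D q X \<and> marked_paired_graph D q Y \<and> paired_graph_iso X Y}"

definition stacked_map_classes :: "nat \<Rightarrow> nat \<Rightarrow> ('w, 'c, 'd) stacked_map set set" where
  "stacked_map_classes D q = {\<Gamma>. stacked_map D q \<Gamma>} //
     {(\<Gamma>, \<Delta>). stacked_map D q \<Gamma> \<and> stacked_map D q \<Delta> \<and> stacked_map_iso \<Gamma> \<Delta>}"

definition Psi_class ::
  "nat \<Rightarrow> nat \<Rightarrow> ('v, 'e) paired_graph set \<Rightarrow> ('w, 'c, 'd) stacked_map set" where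
  "Psi_class D q C = {\<Gamma>. stacked_map D q \<Gamma> \<and> (\<exists>X\<in>C. stacked_map_iso (Psi D X) \<Gamma>)}"

text \<open>
  Edges are the orbits of the involution \<open>opp\<close> on half-edges, vertices the cycles of \<open>rot\<close>
  (the counterclockwise rotation), and \<open>twisted\<close> holds for both halves of an edge of sign -.
  A corner is a pair \<open>(h, rot h)\<close>.
\<close>

record 'h signed_map =
  half_edges :: "'h set"
  rot :: "'h \<Rightarrow> 'h"
  opp :: "'h \<Rightarrow> 'h"
  twisted :: "'h \<Rightarrow> bool"

text \<open>
  Face tracing: a state \<open>(h, s)\<close> is a half-edge along which we are about to leave its vertex,
  together with the current local orientation (\<open>s\<close> holds if it is the one of \<open>rot\<close>).
  We cross the edge, switching the orientation if it is twisted, and then turn at the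
  vertex reached, according to the current orientation.
\<close>

definition cross_edge :: "'h signed_map \<Rightarrow> 'h \<times> bool \<Rightarrow> 'h \<times> bool" where
  "cross_edge M = (\<lambda>(h, s). (opp M h, if twisted M h then \<not> s else s))"

definition rot_inv :: "'h signed_map \<Rightarrow> 'h \<Rightarrow> 'h" where
  "rot_inv M = inv_into (half_edges M) (rot M)"

definition turn :: "'h signed_map \<Rightarrow> 'h \<times> bool \<Rightarrow> 'h \<times> bool" where
  "turn M = (\<lambda>(h, s). (if s then rot M h else rot_inv M h, s))"

definition turn_corner :: "'h signed_map \<Rightarrow> 'h \<times> bool \<Rightarrow> 'h \<times> 'h" where
  "turn_corner M = (\<lambda>(h, s). if s then (h, rot M h) else (rot_inv M h, h))"

definition face_step :: "'h signed_map \<Rightarrow> 'h \<times> bool \<Rightarrow> 'h \<times> bool" where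
  "face_step M = turn M \<circ> cross_edge M"

text \<open>
  A face is represented by the set of corners it visits. These sets partition the set of
  corners, and the two directions in which a face may be traced give the same set.
\<close>

definition map_faces :: "'h signed_map \<Rightarrow> ('h \<times> 'h) set set" where
  "map_faces M = {(turn_corner M \<circ> cross_edge M) ` orbit (face_step M) (h, s) | h s.
     h \<in> half_edges M}"

text \<open>A half-edge is an edge together with one of its two ends.\<close>

datatype edge_end = White_End | Colored_End

definition other_edge ::
  "('w, 'c, 'd) stacked_map \<Rightarrow> nat \<Rightarrow> nat \<Rightarrow> 'd \<Rightarrow> 'd" where
  "other_edge \<Gamma> i j e = (THE f. f \<in> map_edges \<Gamma> \<and> edge_white \<Gamma> f = edge_white \<Gamma> e \<and>
     edge_color \<Gamma> f \<in> {i, j} \<and> f \<noteq> e)"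

definition bicolored_submap ::
  "('w, 'c, 'd) stacked_map \<Rightarrow> nat \<Rightarrow> nat \<Rightarrow> ('d \<times> edge_end) signed_map" where
  "bicolored_submap \<Gamma> i j =
     \<lparr> half_edges = {e \<in> map_edges \<Gamma>. edge_color \<Gamma> e \<in> {i, j}} \<times> UNIV,
       rot = (\<lambda>(e, t). case t of White_End \<Rightarrow> (other_edge \<Gamma> i j e, White_End)
                               | Colored_End \<Rightarrow> (next_edge \<Gamma> e, Colored_End)),
       opp = (\<lambda>(e, t). case t of White_End \<Rightarrow> (e, Colored_End)
                               | Colored_End \<Rightarrow> (e, White_End)),
       twisted = (\<lambda>_. False) \<rparr>"

definition twisted_submap ::
  "('w, 'c, 'd) stacked_map \<Rightarrow> nat \<Rightarrow> nat \<Rightarrow> ('d \<times> edge_end) signed_map" where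
  "twisted_submap \<Gamma> i j =
     (bicolored_submap \<Gamma> i j)\<lparr> twisted := (\<lambda>(e, t). edge_color \<Gamma> e = i) \<rparr>"

text \<open>The corners of the stacked map, i.e. those at colored vertices, that a face visits.\<close>

definition colored_corners :: "(('d \<times> edge_end) \<times> ('d \<times> edge_end)) set \<Rightarrow> ('d \<times> 'd) set" where
  "colored_corners F = {(e, f). ((e, Colored_End), (f, Colored_End)) \<in> F}"

end

theory Submission
  imports Defs
begin

text \<open>
  Given the pairing, a vertex is the same thing as a pair together with a color black or white,
  and an edge is the same thing as a pair (the one of its black end) together with a color; the
  pair of the white end is then given by \<open>\<sigma>\<^sub>i\<close>. So the graph is encoded, up to isomorphism, by
  the permutations \<open>\<sigma>\<^sub>i\<close> of the set of pairs, and the stacked map, read around its colored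
  vertices, encodes exactly the same data. Conversely a stacked map gives a graph: split each white
  vertex into a black and a white one, and turn the corner between an edge and its successor
  into an edge from the black half of the first to the white half of the second.

  For the faces, note that tracing a face of the twisted submap turns at color-\<open>j\<close> vertices by
  \<open>\<sigma>\<^sub>j\<close> when it turns at color-\<open>i\<close> vertices by the inverse of \<open>\<sigma>\<^sub>i\<close>, or the other way round. This is
  how one walks along a bicolored cycle of the graph: alternately from black to white and
  from white to black. The corners visited at the colored vertices are the edges of the cycle,
  and those visited at the white vertices are its vertices.
\<close>

section \<open>Orbits\<close>

text \<open>Two features shape the proof. The permutations are total functions whose values off the
  pairs, or off the edges of a map, are arbitrary, and \<open>orbit f x\<close> starts at
  \<open>f x\<close> rather than at \<open>x\<close>. So statements about cycles carry an invariant
  set on which the function is known, and that a point lies on its own cycle rests on finiteness and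
  injectivity. A bicolored cycle can be travelled in two directions, which give two different orbits
  of \<open>face_step\<close>; only the set of corners passed is common to them. Hence the
  comparison with the graph is not a conjugation of permutations: an orbit stays inside one
  component, and each vertex of the component is entered by it in at least one of the two
  directions. \<open>Psi D X\<close> is labelled by sets of vertices, while the classes live on
  arbitrary infinite label types. Injectivity and well-definedness on classes therefore pass through
  a relabelled copy, and through the equivalence between isomorphism of graphs and isomorphism of
  their images.\<close>

lemma orbit_subset:
  assumes "x \<in> A" "\<And>y. y \<in> A \<Longrightarrow> f y \<in> A"
  shows "orbit f x \<subseteq> A"
proof
  fix y assume "y \<in> orbit f x"
  then show "y \<in> A" by induction (use assms in auto)
qed

text \<open>This is how cycles are transported throughout: between pairs and edges of a map, and
  along isomorphisms.\<close>

lemma orbit_conj: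
  assumes "x \<in> A" "\<And>y. y \<in> A \<Longrightarrow> f y \<in> A" "\<And>y. y \<in> A \<Longrightarrow> h (f y) = g (h y)"
  shows "orbit g (h x) = h ` orbit f x"
proof
  have sub: "orbit f x \<subseteq> A" using assms(1,2) by (rule orbit_subset)
  show "orbit g (h x) \<subseteq> h ` orbit f x"
  proof
    fix z assume "z \<in> orbit g (h x)"
    then show "z \<in> h ` orbit f x"
    proof induction
      case base
      have "g (h x) = h (f x)" using assms by simp
      then show ?case using orbit.base by fast
    next
      case (step z)
      then obtain y where y: "y \<in> orbit f x" "z = h y" by auto
      then have "g z = h (f y)" using assms(3) sub by auto
      then show ?case using y(1) orbit.step by fast
    qed
  qed
  show "h ` orbit f x \<subseteq> orbit g (h x)"
  proof clarify
    fix y assume "y \<in> orbit f x"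
    then show "h y \<in> orbit g (h x)"
    proof induction
      case base
      have "g (h x) = h (f x)" using assms by simp
      then show ?case using orbit.base by metis
    next
      case (step y)
      then have "g (h y) = h (f y)" using assms(3) sub by auto
      then show ?case using step orbit.step by metis
    qed
  qed
qed

text \<open>Pigeonhole: \<open>f\<close> maps the orbit together with \<open>x\<close> into the
  orbit, so an injective \<open>f\<close> leaves no room for \<open>x\<close> outside it.\<close>

lemma finite_inj_in_orbit:
  assumes "finite S" "x \<in> S" "\<And>y. y \<in> S \<Longrightarrow> f y \<in> S" "inj_on f S"
  shows "x \<in> orbit f x"
proof (rule ccontr)
  assume x: "x \<notin> orbit f x"
  have sub: "orbit f x \<subseteq> S" using assms(2,3) by (rule orbit_subset)
  then have fin: "finite (orbit f x)" using assms(1) finite_subset by blast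
  have "f ` insert x (orbit f x) \<subseteq> orbit f x" by (auto intro: orbit.intros)
  then have "card (f ` insert x (orbit f x)) \<le> card (orbit f x)" by (rule card_mono[OF fin])
  moreover have "inj_on f (insert x (orbit f x))"
    using assms(2) sub by (intro inj_on_subset[OF assms(4)]) auto
  ultimately show False using x fin by (simp add: card_image)
qed

section \<open>Pairings and the permutations of the pairs\<close>

locale paired_graph =
  fixes D :: nat and X :: "('v, 'e) paired_graph"
  assumes graph: "colored_graph D X" and pairing: "is_pairing X (pairing X)"
begin

abbreviation "vertices \<equiv> blacks X \<union> whites X"

abbreviation "vertex_label \<equiv> \<lambda>v. (v \<in> blacks X, pair_of X v)"

text \<open>The values on edges are elements of \<open>map_edges (Psi D X)\<close>: the corner of an
  edge \<open>e\<close> leads from \<open>black_label e\<close> to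
  \<open>white_label e\<close>.\<close>

abbreviation "black_label \<equiv> \<lambda>e. (color X e, pair_of X (black_end X e))"

abbreviation "white_label \<equiv> \<lambda>e. (color X e, pair_of X (white_end X e))"

lemma finite_vertices: "finite vertices"
  and disjoint: "v \<in> blacks X \<Longrightarrow> v \<notin> whites X"
  and edge_ends: "e \<in> edges X \<Longrightarrow> black_end X e \<in> blacks X"
    "e \<in> edges X \<Longrightarrow> white_end X e \<in> whites X" "e \<in> edges X \<Longrightarrow> color X e \<le> D"
  and black_ex1: "v \<in> blacks X \<Longrightarrow> i \<le> D \<Longrightarrow>
    \<exists>!e. e \<in> edges X \<and> color X e = i \<and> black_end X e = v"
  and white_ex1: "v \<in> whites X \<Longrightarrow> i \<le> D \<Longrightarrow>
    \<exists>!e. e \<in> edges X \<and> color X e = i \<and> white_end X e = v"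
  using graph unfolding colored_graph_def by auto

lemma pair_ex1:
  assumes "v \<in> vertices"
  shows "\<exists>!\<pi>. \<pi> \<in> pairing X \<and> v \<in> \<pi>"
proof -
  have "partition_on vertices (pairing X)" using pairing unfolding is_pairing_def by auto
  then show ?thesis using assms unfolding partition_on_def disjoint_def by blast
qed

lemma pair_of: "v \<in> vertices \<Longrightarrow> pair_of X v \<in> pairing X" "v \<in> vertices \<Longrightarrow> v \<in> pair_of X v"
  using theI'[OF pair_ex1] unfolding pair_of_def by auto

lemma pair_of_eq: "v \<in> vertices \<Longrightarrow> \<pi> \<in> pairing X \<Longrightarrow> v \<in> \<pi> \<Longrightarrow> pair_of X v = \<pi>"
  using pair_ex1 pair_of by blast

lemma pair_subset: "\<pi> \<in> pairing X \<Longrightarrow> \<pi> \<subseteq> vertices"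
  using pairing unfolding is_pairing_def by auto

lemma pair_eq: "\<pi> \<in> pairing X \<Longrightarrow> \<pi> = {v \<in> vertices. pair_of X v = \<pi>}"
  using pair_subset pair_of_eq pair_of(2) by blast

lemma pair_members:
  assumes "\<pi> \<in> pairing X"
  obtains b w where "b \<in> blacks X" "w \<in> whites X" "\<pi> = {b, w}"
  using assms pairing unfolding is_pairing_def by auto

lemma finite_pairing: "finite (pairing X)"
proof (rule finite_subset)
  show "pairing X \<subseteq> Pow vertices" using pair_subset by auto
qed (use finite_vertices in simp)

lemma bij_vertex_label: "bij_betw vertex_label vertices (UNIV \<times> pairing X)"
proof (rule bij_betw_imageI)
  show "inj_on vertex_label vertices"
  proof (rule inj_onI)
    fix u v assume uv: "u \<in> vertices" "v \<in> vertices" "vertex_label u = vertex_label v"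
    obtain b w where bw: "b \<in> blacks X" "w \<in> whites X" "pair_of X u = {b, w}"
      using pair_members pair_of(1)[OF uv(1)] by metis
    have "u \<in> {b, w}" "v \<in> {b, w}" using pair_of(2) uv bw(3) by auto
    then show "u = v" using bw(1,2) uv(3) disjoint by auto
  qed
  show "vertex_label ` vertices = UNIV \<times> pairing X"
  proof
    show "vertex_label ` vertices \<subseteq> UNIV \<times> pairing X" using pair_of by auto
    show "UNIV \<times> pairing X \<subseteq> vertex_label ` vertices"
    proof clarify
      fix s \<pi> assume p: "\<pi> \<in> pairing X"
      then obtain b w where bw: "b \<in> blacks X" "w \<in> whites X" "\<pi> = {b, w}"
        by (rule pair_members)
      have "pair_of X b = \<pi>" "pair_of X w = \<pi>"
        using bw(1,2) p pair_of_eq[of b \<pi>] pair_of_eq[of w \<pi>] unfolding bw(3) by auto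
      moreover have "w \<notin> blacks X" using bw disjoint by auto
      ultimately have "(s, \<pi>) = vertex_label (if s then b else w)" using bw by auto
      then show "(s, \<pi>) \<in> vertex_label ` vertices" by (rule image_eqI) (use bw in auto)
    qed
  qed
qed

lemma vertex_eqI:
  "u \<in> vertices \<Longrightarrow> v \<in> vertices \<Longrightarrow> u \<in> blacks X \<longleftrightarrow> v \<in> blacks X \<Longrightarrow> pair_of X u = pair_of X v
    \<Longrightarrow> u = v"
  using bij_betw_imp_inj_on[OF bij_vertex_label] by (auto dest: inj_onD)

lemma vertex_cases:
  assumes "\<pi> \<in> pairing X"
  obtains v where "v \<in> vertices" "v \<in> blacks X \<longleftrightarrow> s" "pair_of X v = \<pi>"
proof -
  have "(s, \<pi>) \<in> vertex_label ` vertices"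
    using bij_betw_imp_surj_on[OF bij_vertex_label] assms by auto
  then show ?thesis using that by auto
qed

lemma bij_black_label: "bij_betw black_label (edges X) ({..D} \<times> pairing X)"
proof (rule bij_betw_imageI)
  show "inj_on black_label (edges X)"
  proof (rule inj_onI)
    fix e f assume ef: "e \<in> edges X" "f \<in> edges X" "black_label e = black_label f"
    have "black_end X e = black_end X f" using ef edge_ends by (intro vertex_eqI) auto
    then show "e = f" using ef black_ex1[of "black_end X e" "color X e"] edge_ends by auto
  qed
  show "black_label ` edges X = {..D} \<times> pairing X"
  proof
    show "black_label ` edges X \<subseteq> {..D} \<times> pairing X" using pair_of edge_ends by auto
    show "{..D} \<times> pairing X \<subseteq> black_label ` edges X"
    proof clarify
      fix i \<pi> assume i: "i \<le> D" and p: "\<pi> \<in> pairing X"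
      obtain b where b: "b \<in> vertices" "b \<in> blacks X" "pair_of X b = \<pi>"
        using vertex_cases[OF p, of True] by auto
      obtain e where "e \<in> edges X" "color X e = i" "black_end X e = b"
        using black_ex1[OF b(2) i] by auto
      then show "(i, \<pi>) \<in> black_label ` edges X" using b by (intro image_eqI) auto
    qed
  qed
qed

text \<open>With \<open>bij_black_label\<close> this is the reason that each
  \<open>\<sigma>\<^sub>i\<close> is a permutation: the edges of color \<open>i\<close> are in
  bijection with the pairs by their black ends and also by their white ends, and
  \<open>\<sigma>\<^sub>i\<close> passes from one to the other.\<close>

lemma bij_white_label: "bij_betw white_label (edges X) ({..D} \<times> pairing X)"
proof (rule bij_betw_imageI)
  show "inj_on white_label (edges X)"
  proof (rule inj_onI)
    fix e f assume ef: "e \<in> edges X" "f \<in> edges X" "white_label e = white_label f"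
    have "white_end X e = white_end X f"
      using ef edge_ends disjoint by (intro vertex_eqI) auto
    then show "e = f" using ef white_ex1[of "white_end X e" "color X e"] edge_ends by auto
  qed
  show "white_label ` edges X = {..D} \<times> pairing X"
  proof
    show "white_label ` edges X \<subseteq> {..D} \<times> pairing X" using pair_of edge_ends by auto
    show "{..D} \<times> pairing X \<subseteq> white_label ` edges X"
    proof clarify
      fix i \<pi> assume i: "i \<le> D" and p: "\<pi> \<in> pairing X"
      obtain w where w: "w \<in> vertices" "w \<notin> blacks X" "pair_of X w = \<pi>"
        using vertex_cases[OF p, of False] by auto
      then obtain e where "e \<in> edges X" "color X e = i" "white_end X e = w"
        using white_ex1[of w, OF _ i] by auto
      then show "(i, \<pi>) \<in> white_label ` edges X" using w by (intro image_eqI) auto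
    qed
  qed
qed

lemma edge_eqI:
  "e \<in> edges X \<Longrightarrow> f \<in> edges X \<Longrightarrow> color X e = color X f \<Longrightarrow>
    pair_of X (black_end X e) = pair_of X (black_end X f) \<Longrightarrow> e = f"
  "e \<in> edges X \<Longrightarrow> f \<in> edges X \<Longrightarrow> color X e = color X f \<Longrightarrow>
    pair_of X (white_end X e) = pair_of X (white_end X f) \<Longrightarrow> e = f"
  using bij_betw_imp_inj_on[OF bij_black_label] bij_betw_imp_inj_on[OF bij_white_label]
  by (auto dest: inj_onD)

text \<open>The color and the pair of the black end determine the edge, so the description in
  \<open>sigma_def\<close> singles out one pair. Facts about \<open>sigma\<close> are obtained from
  here by choosing an edge.\<close>

lemma sigma_edge:
  assumes "e \<in> edges X"
  shows "sigma X (color X e) (pair_of X (black_end X e)) = pair_of X (white_end X e)"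
  unfolding sigma_def
proof (rule the_equality)
  show "pair_of X (white_end X e) \<in> pairing X \<and> (\<exists>f\<in>edges X. color X f = color X e \<and>
    black_end X f \<in> pair_of X (black_end X e) \<and> white_end X f \<in> pair_of X (white_end X e))"
    using assms pair_of edge_ends by blast
next
  fix \<pi> assume "\<pi> \<in> pairing X \<and> (\<exists>f\<in>edges X. color X f = color X e \<and>
    black_end X f \<in> pair_of X (black_end X e) \<and> white_end X f \<in> \<pi>)"
  then obtain f where f: "\<pi> \<in> pairing X" "f \<in> edges X" "color X f = color X e"
    "black_end X f \<in> pair_of X (black_end X e)" "white_end X f \<in> \<pi>" by auto
  have "pair_of X (black_end X f) = pair_of X (black_end X e)"
    using f assms pair_of edge_ends by (intro pair_of_eq) auto
  then have "e = f" using f assms edge_eqI(1) by metis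
  then show "\<pi> = pair_of X (white_end X e)"
    using f edge_ends pair_of_eq[of "white_end X f" \<pi>] by auto
qed

lemma edge_cases:
  assumes "\<pi> \<in> pairing X" "i \<le> D"
  obtains e where "e \<in> edges X" "color X e = i" "pair_of X (black_end X e) = \<pi>"
    "sigma X i \<pi> = pair_of X (white_end X e)"
proof -
  have "(i, \<pi>) \<in> black_label ` edges X"
    using bij_betw_imp_surj_on[OF bij_black_label] assms by auto
  then show ?thesis using that sigma_edge by auto
qed

lemma sigma_in: "\<pi> \<in> pairing X \<Longrightarrow> i \<le> D \<Longrightarrow> sigma X i \<pi> \<in> pairing X"
  by (metis UnI2 edge_cases edge_ends(2) pair_of(1))

lemma inj_sigma:
  assumes "i \<le> D"
  shows "inj_on (sigma X i) (pairing X)"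
proof (rule inj_onI)
  fix \<pi> \<rho> assume *: "\<pi> \<in> pairing X" "\<rho> \<in> pairing X" "sigma X i \<pi> = sigma X i \<rho>"
  obtain e where e: "e \<in> edges X" "color X e = i" "pair_of X (black_end X e) = \<pi>"
    "sigma X i \<pi> = pair_of X (white_end X e)" using edge_cases[OF *(1) assms] by metis
  obtain f where f: "f \<in> edges X" "color X f = i" "pair_of X (black_end X f) = \<rho>"
    "sigma X i \<rho> = pair_of X (white_end X f)" using edge_cases[OF *(2) assms] by metis
  show "\<pi> = \<rho>" using e f *(3) edge_eqI(2)[of e f] by auto
qed

lemma sigma_orbit:
  assumes "\<pi> \<in> pairing X" "i \<le> D"
  shows "\<pi> \<in> orbit (sigma X i) \<pi>" "orbit (sigma X i) \<pi> \<subseteq> pairing X"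
    "cyclic_on (sigma X i) (orbit (sigma X i) \<pi>)"
proof -
  show *: "\<pi> \<in> orbit (sigma X i) \<pi>"
    using finite_inj_in_orbit[OF finite_pairing _ _ inj_sigma] assms sigma_in by metis
  show "orbit (sigma X i) \<pi> \<subseteq> pairing X" by (rule orbit_subset) (use assms sigma_in in auto)
  show "cyclic_on (sigma X i) (orbit (sigma X i) \<pi>)" using * unfolding cyclic_on_def by blast
qed

lemma orbit_eq:
  "\<pi> \<in> pairing X \<Longrightarrow> i \<le> D \<Longrightarrow> \<rho> \<in> orbit (sigma X i) \<pi> \<Longrightarrow> orbit (sigma X i) \<rho> = orbit (sigma X i) \<pi>"
  by (rule orbit_cyclic_eq3[OF sigma_orbit(3)])

text \<open>This puts the corner in the form of an edge of \<open>Psi D X\<close> followed by its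
  successor, as the axioms for marked corners require.\<close>

lemma corner_of_edge:
  "e \<in> edges X \<Longrightarrow> corner_of X e = (black_label e, color X e, sigma X (color X e) (snd (black_label e)))"
  by (simp add: corner_of_def sigma_edge)

lemma inj_corner_of: "inj_on (corner_of X) (edges X)"
  using edge_eqI(1) by (auto simp: corner_of_def intro!: inj_onI)

lemma stacked_map_Psi:
  assumes "marked_paired_graph D q X"
  shows "stacked_map D q (Psi D X)"
proof -
  have marked: "marked_edges X \<subseteq> {e \<in> edges X. color X e = 0}"
    "inj_on (\<lambda>e. orbit (sigma X 0) (pair_of X (black_end X e))) (marked_edges X)"
    "card (marked_edges X) = q"
    using assms unfolding marked_paired_graph_def by auto
  have cyc: "cyclic_on (next_edge (Psi D X))
      {e \<in> map_edges (Psi D X). edge_col (Psi D X) e = (i, orbit (sigma X i) \<pi>)}"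
    if "i \<le> D" "\<pi> \<in> pairing X" for i \<pi>
  proof -
    have "{e \<in> map_edges (Psi D X). edge_col (Psi D X) e = (i, orbit (sigma X i) \<pi>)}
      = Pair i ` orbit (sigma X i) \<pi>"
    proof -
      \<comment> \<open>A colored vertex is named by its orbit as a set, so its star consists of the
        pairs with that orbit. These are the elements of the orbit, because every pair lies in its
        own.\<close>
      have "orbit (sigma X i) \<rho> = orbit (sigma X i) \<pi> \<longleftrightarrow> \<rho> \<in> orbit (sigma X i) \<pi>"
        if "\<rho> \<in> pairing X" for \<rho>
        using sigma_orbit(1)[OF that \<open>i \<le> D\<close>] orbit_eq[OF \<open>\<pi> \<in> pairing X\<close> \<open>i \<le> D\<close>, of \<rho>] by metis
      then show ?thesis using that sigma_orbit(2)[of \<pi> i] by (auto simp: Psi_def)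
    qed
    also have "\<dots> = orbit (next_edge (Psi D X)) (i, \<pi>)"
      by (rule orbit_conj[symmetric, where A = UNIV]) (auto simp: Psi_def)
    finally have eq: "{e \<in> map_edges (Psi D X). edge_col (Psi D X) e = (i, orbit (sigma X i) \<pi>)}
      = orbit (next_edge (Psi D X)) (i, \<pi>)" .
    have "(i, \<pi>) \<in> {e \<in> map_edges (Psi D X). edge_col (Psi D X) e = (i, orbit (sigma X i) \<pi>)}"
      using that by (simp add: Psi_def)
    then show ?thesis unfolding cyclic_on_def eq by blast
  qed
  have col: "col_verts (Psi D X) = (\<lambda>(i, \<pi>). (i, orbit (sigma X i) \<pi>)) ` ({..D} \<times> pairing X)"
    by (auto simp: Psi_def)
  have "finite (col_verts (Psi D X))" unfolding col using finite_pairing by simp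
  moreover have "\<forall>c\<in>col_verts (Psi D X).
      cyclic_on (next_edge (Psi D X)) {e \<in> map_edges (Psi D X). edge_col (Psi D X) e = c}"
    unfolding col using cyc by auto
  moreover have "card (corner_of X ` marked_edges X) = q"
    using inj_on_subset[OF inj_corner_of] marked by (subst card_image) auto
  \<comment> \<open>The color-0 vertex carrying the corner of a marked edge is the orbit of the pair
    of its black end, so one mark per cycle in the graph means one mark per vertex here.\<close>
  moreover have "inj_on (\<lambda>(e, f). edge_col (Psi D X) e) (corner_of X ` marked_edges X)"
  proof (rule inj_onI)
    fix c d
    assume cd: "c \<in> corner_of X ` marked_edges X" "d \<in> corner_of X ` marked_edges X"
      "(\<lambda>(e, f). edge_col (Psi D X) e) c = (\<lambda>(e, f). edge_col (Psi D X) e) d"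
    then obtain e f where ef: "e \<in> marked_edges X" "f \<in> marked_edges X"
      "c = corner_of X e" "d = corner_of X f" by auto
    then have "color X e = 0" "color X f = 0" using marked(1) by auto
    then have "e = f" using ef cd(3) inj_onD[OF marked(2)] by (auto simp: corner_of_def Psi_def)
    then show "c = d" using ef by simp
  qed
  moreover have "corner_of X ` marked_edges X \<subseteq>
    {(e, next_edge (Psi D X) e) | e. e \<in> map_edges (Psi D X) \<and> edge_color (Psi D X) e = 0}"
    using marked(1) edge_ends pair_of by (auto simp: corner_of_edge Psi_def subset_iff)
  ultimately show ?thesis
    using finite_pairing unfolding stacked_map_def
    by (auto simp: Psi_def)
qed

end

lemma marked_paired_graph_imp_paired_graph:
  "marked_paired_graph D q X \<Longrightarrow> paired_graph D X"
  unfolding marked_paired_graph_def paired_graph_def by simp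

section \<open>Isomorphisms of stacked maps\<close>

locale stacked =
  fixes D q :: nat and \<Gamma> :: "('w, 'c, 'd) stacked_map"
  assumes stacked_map: "stacked_map D q \<Gamma>"
begin

lemma finite_white: "finite (white_verts \<Gamma>)"
  and finite_col: "finite (col_verts \<Gamma>)"
  and finite_map_edges: "finite (map_edges \<Gamma>)"
  and vert_color_le: "c \<in> col_verts \<Gamma> \<Longrightarrow> vert_color \<Gamma> c \<le> D"
  and edge_white_in: "e \<in> map_edges \<Gamma> \<Longrightarrow> edge_white \<Gamma> e \<in> white_verts \<Gamma>"
  and edge_col_in: "e \<in> map_edges \<Gamma> \<Longrightarrow> edge_col \<Gamma> e \<in> col_verts \<Gamma>"
  and edge_color: "e \<in> map_edges \<Gamma> \<Longrightarrow> edge_color \<Gamma> e = vert_color \<Gamma> (edge_col \<Gamma> e)"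
  and edge_ex1: "w \<in> white_verts \<Gamma> \<Longrightarrow> i \<le> D \<Longrightarrow>
    \<exists>!e. e \<in> map_edges \<Gamma> \<and> edge_color \<Gamma> e = i \<and> edge_white \<Gamma> e = w"
  and cyclic: "c \<in> col_verts \<Gamma> \<Longrightarrow> cyclic_on (next_edge \<Gamma>) {e \<in> map_edges \<Gamma>. edge_col \<Gamma> e = c}"
  and marked: "marked_corners \<Gamma> \<subseteq> {(e, next_edge \<Gamma> e) | e. e \<in> map_edges \<Gamma> \<and> edge_color \<Gamma> e = 0}"
  and inj_marked: "inj_on (\<lambda>(e, f). edge_col \<Gamma> e) (marked_corners \<Gamma>)"
  and card_marked: "card (marked_corners \<Gamma>) = q"
  using stacked_map unfolding stacked_map_def by blast+

lemma edge_color_le: "e \<in> map_edges \<Gamma> \<Longrightarrow> edge_color \<Gamma> e \<le> D"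
  using edge_color vert_color_le edge_col_in by metis

lemma next_edge:
  assumes "e \<in> map_edges \<Gamma>"
  shows "next_edge \<Gamma> e \<in> map_edges \<Gamma>" "edge_col \<Gamma> (next_edge \<Gamma> e) = edge_col \<Gamma> e"
    "edge_color \<Gamma> (next_edge \<Gamma> e) = edge_color \<Gamma> e"
proof -
  show 1: "next_edge \<Gamma> e \<in> map_edges \<Gamma>" and 2: "edge_col \<Gamma> (next_edge \<Gamma> e) = edge_col \<Gamma> e"
    using cyclic_on_inI[OF cyclic[OF edge_col_in[OF assms]], of e] assms by auto
  show "edge_color \<Gamma> (next_edge \<Gamma> e) = edge_color \<Gamma> e"
    using edge_color[OF assms] edge_color[OF 1] 2 by simp
qed

text \<open>Each edge lies in its own orbit and hence is a successor; a surjection of a finite set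
  onto itself is injective.\<close>

lemma inj_next_edge: "inj_on (next_edge \<Gamma>) (map_edges \<Gamma>)"
proof -
  have "map_edges \<Gamma> \<subseteq> next_edge \<Gamma> ` map_edges \<Gamma>"
  proof
    fix e assume e: "e \<in> map_edges \<Gamma>"
    let ?S = "{f \<in> map_edges \<Gamma>. edge_col \<Gamma> f = edge_col \<Gamma> e}"
    have cyc: "cyclic_on (next_edge \<Gamma>) ?S" using cyclic edge_col_in[OF e] by simp
    have "e \<in> ?S" using e by simp
    then have "e \<in> orbit (next_edge \<Gamma>) e" using orbit_cyclic_eq3[OF cyc] by simp
    then show "e \<in> next_edge \<Gamma> ` map_edges \<Gamma>"
    proof cases
      case base
      then show ?thesis using e by auto
    next
      case (step f)
      then have "f \<in> ?S" using orbit_cyclic_eq3[OF cyc \<open>e \<in> ?S\<close>] by simp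
      then show ?thesis using step by auto
    qed
  qed
  then have "next_edge \<Gamma> ` map_edges \<Gamma> = map_edges \<Gamma>" using next_edge by auto
  then show ?thesis using finite_map_edges by (metis eq_card_imp_inj_on)
qed

lemma edge_at_col:
  assumes "c \<in> col_verts \<Gamma>"
  obtains e where "e \<in> map_edges \<Gamma>" "edge_col \<Gamma> e = c"
  using cyclic[OF assms] unfolding cyclic_on_def by auto

lemma marked_in: "marked_corners \<Gamma> \<subseteq> map_edges \<Gamma> \<times> map_edges \<Gamma>"
  using marked next_edge by auto

lemma edge_eqI:
  "e \<in> map_edges \<Gamma> \<Longrightarrow> f \<in> map_edges \<Gamma> \<Longrightarrow> edge_color \<Gamma> e = edge_color \<Gamma> f \<Longrightarrow>
    edge_white \<Gamma> e = edge_white \<Gamma> f \<Longrightarrow> e = f"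
  using edge_ex1 edge_white_in edge_color_le by metis

lemma edge_cases:
  assumes "w \<in> white_verts \<Gamma>" "i \<le> D"
  obtains e where "e \<in> map_edges \<Gamma>" "edge_color \<Gamma> e = i" "edge_white \<Gamma> e = w"
  using edge_ex1[OF assms] by auto

end

lemma stacked_map_iso_trans:
  assumes "stacked_map D q \<Gamma>" "stacked_map_iso \<Gamma> \<Delta>" "stacked_map_iso \<Delta> \<Theta>"
  shows "stacked_map_iso \<Gamma> \<Theta>"
proof -
  interpret stacked D q \<Gamma> by standard fact
  obtain fw fc fe where f: "bij_betw fw (white_verts \<Gamma>) (white_verts \<Delta>)"
    "bij_betw fc (col_verts \<Gamma>) (col_verts \<Delta>)"
    "bij_betw fe (map_edges \<Gamma>) (map_edges \<Delta>)"
    "\<And>c. c\<in>col_verts \<Gamma> \<Longrightarrow> vert_color \<Delta> (fc c) = vert_color \<Gamma> c"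
    "\<And>e. e\<in>map_edges \<Gamma> \<Longrightarrow> edge_color \<Delta> (fe e) = edge_color \<Gamma> e \<and>
        edge_white \<Delta> (fe e) = fw (edge_white \<Gamma> e) \<and>
        edge_col \<Delta> (fe e) = fc (edge_col \<Gamma> e) \<and>
        next_edge \<Delta> (fe e) = fe (next_edge \<Gamma> e)"
    "map_prod fe fe ` marked_corners \<Gamma> = marked_corners \<Delta>"
    using assms(2) unfolding stacked_map_iso_def by auto
  obtain gw gc ge where g: "bij_betw gw (white_verts \<Delta>) (white_verts \<Theta>)"
    "bij_betw gc (col_verts \<Delta>) (col_verts \<Theta>)"
    "bij_betw ge (map_edges \<Delta>) (map_edges \<Theta>)"
    "\<And>c. c\<in>col_verts \<Delta> \<Longrightarrow> vert_color \<Theta> (gc c) = vert_color \<Delta> c"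
    "\<And>e. e\<in>map_edges \<Delta> \<Longrightarrow> edge_color \<Theta> (ge e) = edge_color \<Delta> e \<and>
        edge_white \<Theta> (ge e) = gw (edge_white \<Delta> e) \<and>
        edge_col \<Theta> (ge e) = gc (edge_col \<Delta> e) \<and>
        next_edge \<Theta> (ge e) = ge (next_edge \<Delta> e)"
    "map_prod ge ge ` marked_corners \<Delta> = marked_corners \<Theta>"
    using assms(3) unfolding stacked_map_iso_def by auto
  have in\<Delta>: "c \<in> col_verts \<Gamma> \<Longrightarrow> fc c \<in> col_verts \<Delta>" "e \<in> map_edges \<Gamma> \<Longrightarrow> fe e \<in> map_edges \<Delta>" for c e
    using f(2,3) bij_betwE by auto
  show ?thesis
    unfolding stacked_map_iso_def
  proof (intro exI conjI)
    show "bij_betw (gw \<circ> fw) (white_verts \<Gamma>) (white_verts \<Theta>)"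
      "bij_betw (gc \<circ> fc) (col_verts \<Gamma>) (col_verts \<Theta>)"
      "bij_betw (ge \<circ> fe) (map_edges \<Gamma>) (map_edges \<Theta>)"
      using f(1-3) g(1-3) by (blast intro: bij_betw_trans)+
    show "\<forall>c\<in>col_verts \<Gamma>. vert_color \<Theta> ((gc \<circ> fc) c) = vert_color \<Gamma> c"
      using f(4) g(4) in\<Delta> by simp
    show "\<forall>e\<in>map_edges \<Gamma>. edge_color \<Theta> ((ge \<circ> fe) e) = edge_color \<Gamma> e \<and>
       edge_white \<Theta> ((ge \<circ> fe) e) = (gw \<circ> fw) (edge_white \<Gamma> e) \<and>
       edge_col \<Theta> ((ge \<circ> fe) e) = (gc \<circ> fc) (edge_col \<Gamma> e) \<and>
       next_edge \<Theta> ((ge \<circ> fe) e) = (ge \<circ> fe) (next_edge \<Gamma> e)"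
      using f(5) g(5) in\<Delta> by simp
    show "map_prod (ge \<circ> fe) (ge \<circ> fe) ` marked_corners \<Gamma> = marked_corners \<Theta>"
      unfolding g(6)[symmetric] f(6)[symmetric] map_prod_compose image_comp ..
  qed
qed

text \<open>The inverse bijections undo the given ones only on the carriers. The axioms of
  \<open>\<Gamma>\<close> keep ends, successors and marked corners there.\<close>

lemma stacked_map_iso_sym:
  assumes "stacked_map D q \<Gamma>" "stacked_map_iso \<Gamma> \<Delta>"
  shows "stacked_map_iso \<Delta> \<Gamma>"
proof -
  interpret stacked D q \<Gamma> by standard fact
  obtain fw fc fe where f: "bij_betw fw (white_verts \<Gamma>) (white_verts \<Delta>)"
    "bij_betw fc (col_verts \<Gamma>) (col_verts \<Delta>)"
    "bij_betw fe (map_edges \<Gamma>) (map_edges \<Delta>)"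
    "\<And>c. c\<in>col_verts \<Gamma> \<Longrightarrow> vert_color \<Delta> (fc c) = vert_color \<Gamma> c"
    "\<And>e. e\<in>map_edges \<Gamma> \<Longrightarrow> edge_color \<Delta> (fe e) = edge_color \<Gamma> e \<and>
        edge_white \<Delta> (fe e) = fw (edge_white \<Gamma> e) \<and>
        edge_col \<Delta> (fe e) = fc (edge_col \<Gamma> e) \<and>
        next_edge \<Delta> (fe e) = fe (next_edge \<Gamma> e)"
    "map_prod fe fe ` marked_corners \<Gamma> = marked_corners \<Delta>"
    using assms(2) unfolding stacked_map_iso_def by auto
  let ?gw = "inv_into (white_verts \<Gamma>) fw"
  let ?gc = "inv_into (col_verts \<Gamma>) fc"
  let ?ge = "inv_into (map_edges \<Gamma>) fe"
  have g: "w \<in> white_verts \<Gamma> \<Longrightarrow> ?gw (fw w) = w" "c \<in> col_verts \<Gamma> \<Longrightarrow> ?gc (fc c) = c"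
    "e \<in> map_edges \<Gamma> \<Longrightarrow> ?ge (fe e) = e" for w c e
    using f(1-3) by (auto intro: bij_betw_inv_into_left)
  have sur: "col_verts \<Delta> = fc ` col_verts \<Gamma>" "map_edges \<Delta> = fe ` map_edges \<Gamma>"
    using f(2,3) bij_betw_imp_surj_on by blast+
  show ?thesis
    unfolding stacked_map_iso_def
  proof (intro exI conjI)
    show "bij_betw ?gw (white_verts \<Delta>) (white_verts \<Gamma>)"
      "bij_betw ?gc (col_verts \<Delta>) (col_verts \<Gamma>)"
      "bij_betw ?ge (map_edges \<Delta>) (map_edges \<Gamma>)"
      using f(1-3) bij_betw_inv_into by blast+
    show "\<forall>c\<in>col_verts \<Delta>. vert_color \<Gamma> (?gc c) = vert_color \<Delta> c"
      unfolding sur using g f(4) by auto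
    show "\<forall>e\<in>map_edges \<Delta>. edge_color \<Gamma> (?ge e) = edge_color \<Delta> e \<and>
       edge_white \<Gamma> (?ge e) = ?gw (edge_white \<Delta> e) \<and>
       edge_col \<Gamma> (?ge e) = ?gc (edge_col \<Delta> e) \<and> next_edge \<Gamma> (?ge e) = ?ge (next_edge \<Delta> e)"
      unfolding sur using g f(5) edge_white_in edge_col_in next_edge by auto
    have "map_prod ?ge ?ge ` marked_corners \<Delta> = (\<lambda>x. x) ` marked_corners \<Gamma>"
      unfolding f(6)[symmetric] image_image using marked_in g by (intro image_cong) auto
    then show "map_prod ?ge ?ge ` marked_corners \<Delta> = marked_corners \<Gamma>" by simp
  qed
qed

text \<open>It spares checking the axioms for maps that are obtained by transport, in particular for
  relabelled copies.\<close>

lemma stacked_map_iso_preserves: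
  assumes "stacked_map D q \<Gamma>" "stacked_map_iso \<Gamma> \<Delta>"
  shows "stacked_map D q \<Delta>"
proof -
  interpret stacked D q \<Gamma> by standard fact
  obtain fw fc fe where f: "bij_betw fw (white_verts \<Gamma>) (white_verts \<Delta>)"
    "bij_betw fc (col_verts \<Gamma>) (col_verts \<Delta>)"
    "bij_betw fe (map_edges \<Gamma>) (map_edges \<Delta>)"
    "\<And>c. c\<in>col_verts \<Gamma> \<Longrightarrow> vert_color \<Delta> (fc c) = vert_color \<Gamma> c"
    "\<And>e. e\<in>map_edges \<Gamma> \<Longrightarrow> edge_color \<Delta> (fe e) = edge_color \<Gamma> e \<and>
        edge_white \<Delta> (fe e) = fw (edge_white \<Gamma> e) \<and>
        edge_col \<Delta> (fe e) = fc (edge_col \<Gamma> e) \<and>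
        next_edge \<Delta> (fe e) = fe (next_edge \<Gamma> e)"
    "map_prod fe fe ` marked_corners \<Gamma> = marked_corners \<Delta>"
    using assms(2) unfolding stacked_map_iso_def by auto
  have sur: "white_verts \<Delta> = fw ` white_verts \<Gamma>" "col_verts \<Delta> = fc ` col_verts \<Gamma>"
    "map_edges \<Delta> = fe ` map_edges \<Gamma>"
    using f(1-3) bij_betw_imp_surj_on by blast+
  have inj: "inj_on fw (white_verts \<Gamma>)" "inj_on fc (col_verts \<Gamma>)" "inj_on fe (map_edges \<Gamma>)"
    using f(1-3) bij_betw_imp_inj_on by blast+
  show ?thesis
    unfolding stacked_map_def
  proof (intro conjI)
    show "finite (white_verts \<Delta>)" "finite (col_verts \<Delta>)" "finite (map_edges \<Delta>)"
      unfolding sur using finite_white finite_col finite_map_edges by auto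
    show "\<forall>c\<in>col_verts \<Delta>. vert_color \<Delta> c \<le> D"
      unfolding sur using f(4) vert_color_le by auto
    show "\<forall>e\<in>map_edges \<Delta>. edge_white \<Delta> e \<in> white_verts \<Delta> \<and> edge_col \<Delta> e \<in> col_verts \<Delta> \<and>
        edge_color \<Delta> e = vert_color \<Delta> (edge_col \<Delta> e)"
      unfolding sur using f(4,5) edge_white_in edge_col_in edge_color by simp
    show "\<forall>w\<in>white_verts \<Delta>. \<forall>i\<le>D.
        \<exists>!e. e \<in> map_edges \<Delta> \<and> edge_color \<Delta> e = i \<and> edge_white \<Delta> e = w"
    proof (intro ballI allI impI)
      fix w' i assume "w' \<in> white_verts \<Delta>" and i: "i \<le> D"
      then obtain w where w: "w \<in> white_verts \<Gamma>" "w' = fw w" unfolding sur by auto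
      obtain e where e: "e \<in> map_edges \<Gamma>" "edge_color \<Gamma> e = i" "edge_white \<Gamma> e = w"
        using edge_cases[OF w(1) i] .
      show "\<exists>!e. e \<in> map_edges \<Delta> \<and> edge_color \<Delta> e = i \<and> edge_white \<Delta> e = w'"
      proof (rule ex1I[of _ "fe e"])
        show "fe e \<in> map_edges \<Delta> \<and> edge_color \<Delta> (fe e) = i \<and> edge_white \<Delta> (fe e) = w'"
          using e w f(5) sur by simp
        fix x assume x: "x \<in> map_edges \<Delta> \<and> edge_color \<Delta> x = i \<and> edge_white \<Delta> x = w'"
        then obtain d where d: "d \<in> map_edges \<Gamma>" "x = fe d" unfolding sur by auto
        have "fw (edge_white \<Gamma> d) = fw w" using d x w f(5) by auto
        then have "edge_white \<Gamma> d = w" using inj(1) d w edge_white_in inj_onD by metis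
        then have "d = e" using e d x f(5) by (intro edge_eqI) auto
        then show "x = fe e" using d by simp
      qed
    qed
    show "\<forall>c\<in>col_verts \<Delta>. cyclic_on (next_edge \<Delta>) {e \<in> map_edges \<Delta>. edge_col \<Delta> e = c}"
    proof
      fix c' assume "c' \<in> col_verts \<Delta>"
      then obtain c where c: "c \<in> col_verts \<Gamma>" "c' = fc c" unfolding sur by auto
      let ?S = "{e \<in> map_edges \<Gamma>. edge_col \<Gamma> e = c}"
      obtain e where e: "e \<in> ?S" "?S = orbit (next_edge \<Gamma>) e"
        using cyclic[OF c(1)] unfolding cyclic_on_def by blast
      have "{e \<in> map_edges \<Delta>. edge_col \<Delta> e = c'} = fe ` ?S"
        unfolding sur using c f(5) edge_col_in inj_onD[OF inj(2)] by auto
      also have "\<dots> = orbit (next_edge \<Delta>) (fe e)"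
        unfolding e(2) by (rule orbit_conj[symmetric, where A = "map_edges \<Gamma>"])
          (use e f(5) next_edge in auto)
      finally have eq: "{e \<in> map_edges \<Delta>. edge_col \<Delta> e = c'} = orbit (next_edge \<Delta>) (fe e)" .
      have "fe e \<in> {e \<in> map_edges \<Delta>. edge_col \<Delta> e = c'}" using e(1) c f(5) sur by auto
      then show "cyclic_on (next_edge \<Delta>) {e \<in> map_edges \<Delta>. edge_col \<Delta> e = c'}"
        unfolding cyclic_on_def eq by blast
    qed
    show "marked_corners \<Delta> \<subseteq>
      {(e, next_edge \<Delta> e) | e. e \<in> map_edges \<Delta> \<and> edge_color \<Delta> e = 0}"
    proof
      fix x assume "x \<in> marked_corners \<Delta>"
      then obtain e where "e \<in> map_edges \<Gamma>" "edge_color \<Gamma> e = 0" "x = (fe e, fe (next_edge \<Gamma> e))"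
        unfolding f(6)[symmetric] using marked by auto
      then show "x \<in> {(e, next_edge \<Delta> e) | e. e \<in> map_edges \<Delta> \<and> edge_color \<Delta> e = 0}"
        using f(5) sur by auto
    qed
    show "inj_on (\<lambda>(e, f). edge_col \<Delta> e) (marked_corners \<Delta>)"
    proof (rule inj_onI)
      fix x y assume xy: "x \<in> marked_corners \<Delta>" "y \<in> marked_corners \<Delta>"
        "(\<lambda>(e, f). edge_col \<Delta> e) x = (\<lambda>(e, f). edge_col \<Delta> e) y"
      then obtain u v where uv: "u \<in> marked_corners \<Gamma>" "v \<in> marked_corners \<Gamma>"
        "x = map_prod fe fe u" "y = map_prod fe fe v" unfolding f(6)[symmetric] by auto
      then have m: "fst u \<in> map_edges \<Gamma>" "fst v \<in> map_edges \<Gamma>" using marked_in by auto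
      then have "fc (edge_col \<Gamma> (fst u)) = fc (edge_col \<Gamma> (fst v))"
        using xy(3) uv f(5) by (auto simp: case_prod_unfold)
      then have "edge_col \<Gamma> (fst u) = edge_col \<Gamma> (fst v)"
        using inj(2) m edge_col_in inj_onD by metis
      then have "u = v" using inj_onD[OF inj_marked _ uv(1,2)] by (simp add: case_prod_unfold)
      then show "x = y" using uv by simp
    qed
    have "inj_on (map_prod fe fe) (marked_corners \<Gamma>)"
      using map_prod_inj_on[OF inj(3,3)] marked_in inj_on_subset by blast
    then show "card (marked_corners \<Delta>) = q"
      unfolding f(6)[symmetric] by (simp add: card_image card_marked)
  qed
qed

section \<open>Copies of a stacked map on prescribed label types\<close>

lemma finite_inj_into_infinite:
  assumes "finite A"
  obtains f :: "'a \<Rightarrow> 'b::infinite" where "inj_on f A"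
proof -
  obtain B :: "'b set" where "finite B" "card B = card A"
    using infinite_arbitrarily_large[OF infinite_UNIV] by blast
  then obtain f where "bij_betw f A B" using finite_same_card_bij[OF assms] by metis
  then show ?thesis using that bij_betw_imp_inj_on by blast
qed

text \<open>Applied to \<open>Psi D X\<close>, it provides an element of the class on the target
  label types; without one \<open>Psi_class\<close> could be empty.\<close>

lemma stacked_map_relabel:
  fixes \<Gamma> :: "('a, 'b, 'c) stacked_map"
  assumes "stacked_map D q \<Gamma>"
  obtains \<Delta> :: "('w::infinite, 'x::infinite, 'd::infinite) stacked_map" where
    "stacked_map D q \<Delta>" "stacked_map_iso \<Gamma> \<Delta>"
proof -
  interpret stacked D q \<Gamma> by standard fact
  obtain fw :: "'a \<Rightarrow> 'w" where fw: "inj_on fw (white_verts \<Gamma>)"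
    using finite_inj_into_infinite[OF finite_white] .
  obtain fc :: "'b \<Rightarrow> 'x" where fc: "inj_on fc (col_verts \<Gamma>)"
    using finite_inj_into_infinite[OF finite_col] .
  obtain fe :: "'c \<Rightarrow> 'd" where fe: "inj_on fe (map_edges \<Gamma>)"
    using finite_inj_into_infinite[OF finite_map_edges] .
  define \<Delta> where "\<Delta> =
    \<lparr> white_verts = fw ` white_verts \<Gamma>,
      col_verts = fc ` col_verts \<Gamma>,
      map_edges = fe ` map_edges \<Gamma>,
      vert_color = vert_color \<Gamma> \<circ> inv_into (col_verts \<Gamma>) fc,
      edge_color = edge_color \<Gamma> \<circ> inv_into (map_edges \<Gamma>) fe,
      edge_white = fw \<circ> edge_white \<Gamma> \<circ> inv_into (map_edges \<Gamma>) fe,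
      edge_col = fc \<circ> edge_col \<Gamma> \<circ> inv_into (map_edges \<Gamma>) fe,
      next_edge = fe \<circ> next_edge \<Gamma> \<circ> inv_into (map_edges \<Gamma>) fe,
      marked_corners = map_prod fe fe ` marked_corners \<Gamma> \<rparr>"
  have iso: "stacked_map_iso \<Gamma> \<Delta>"
    unfolding stacked_map_iso_def
  proof (intro exI conjI)
    show "bij_betw fw (white_verts \<Gamma>) (white_verts \<Delta>)"
      "bij_betw fc (col_verts \<Gamma>) (col_verts \<Delta>)"
      "bij_betw fe (map_edges \<Gamma>) (map_edges \<Delta>)"
      using fw fc fe by (simp_all add: \<Delta>_def bij_betw_def)
    show "\<forall>c\<in>col_verts \<Gamma>. vert_color \<Delta> (fc c) = vert_color \<Gamma> c"
      using fc by (simp add: \<Delta>_def)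
    show "\<forall>e\<in>map_edges \<Gamma>. edge_color \<Delta> (fe e) = edge_color \<Gamma> e \<and>
        edge_white \<Delta> (fe e) = fw (edge_white \<Gamma> e) \<and>
        edge_col \<Delta> (fe e) = fc (edge_col \<Gamma> e) \<and> next_edge \<Delta> (fe e) = fe (next_edge \<Gamma> e)"
      using fe by (simp add: \<Delta>_def)
    show "map_prod fe fe ` marked_corners \<Gamma> = marked_corners \<Delta>"
      by (simp add: \<Delta>_def)
  qed
  show ?thesis using that[OF stacked_map_iso_preserves[OF assms iso] iso] .
qed

section \<open>\<open>Psi\<close> on isomorphism classes\<close>

lemma paired_graph_iso_imp_stacked_map_iso_Psi:
  assumes X: "marked_paired_graph D q X" and Y: "marked_paired_graph D q Y"
    and iso: "paired_graph_iso X Y"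
  shows "stacked_map_iso (Psi D X) (Psi D Y)"
proof -
  interpret X: paired_graph D X using X by (rule marked_paired_graph_imp_paired_graph)
  interpret Y: paired_graph D Y using Y by (rule marked_paired_graph_imp_paired_graph)
  obtain fv fe where f: "bij_betw fv X.vertices Y.vertices"
    "fv ` blacks X = blacks Y" "fv ` whites X = whites Y"
    "bij_betw fe (edges X) (edges Y)"
    "\<And>e. e \<in> edges X \<Longrightarrow> black_end Y (fe e) = fv (black_end X e) \<and>
        white_end Y (fe e) = fv (white_end X e) \<and> color Y (fe e) = color X e"
    "(\<lambda>\<pi>. fv ` \<pi>) ` pairing X = pairing Y"
    "fe ` marked_edges X = marked_edges Y"
    using iso unfolding paired_graph_iso_def by auto
  have inj: "inj_on fv X.vertices" using f(1) bij_betw_imp_inj_on by blast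
  have pair: "pair_of Y (fv v) = fv ` pair_of X v" if "v \<in> X.vertices" for v
  proof (rule Y.pair_of_eq)
    show "fv v \<in> Y.vertices" using that f(2,3) by blast
    show "fv ` pair_of X v \<in> pairing Y" using X.pair_of(1)[OF that] f(6) by blast
    show "fv v \<in> fv ` pair_of X v" using X.pair_of(2)[OF that] by blast
  qed
  have sig: "fv ` sigma X i \<pi> = sigma Y i (fv ` \<pi>)" if "\<pi> \<in> pairing X" "i \<le> D" for i \<pi>
  proof -
    obtain e where e: "e \<in> edges X" "color X e = i" "pair_of X (black_end X e) = \<pi>"
      "sigma X i \<pi> = pair_of X (white_end X e)" using X.edge_cases[OF \<open>\<pi> \<in> pairing X\<close> \<open>i \<le> D\<close>] .
    have "fe e \<in> edges Y" using f(4) e(1) bij_betwE by blast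
    from Y.sigma_edge[OF this] show ?thesis using e f(5) pair X.edge_ends by simp
  qed
  have orb: "orbit (sigma Y i) (fv ` \<pi>) = (`) fv ` orbit (sigma X i) \<pi>"
    if "\<pi> \<in> pairing X" "i \<le> D" for i \<pi>
    by (rule orbit_conj[where A = "pairing X"]) (use that sig X.sigma_in in auto)
  \<comment> \<open>Pairs are subsets of the vertex set, on which \<open>fv\<close> is injective, so
    their images determine them.\<close>
  have injp: "inj_on ((`) fv) (pairing X)"
    using X.pair_subset by (intro inj_onI) (metis inj inj_on_image_eq_iff)
  have bijp: "bij_betw ((`) fv) (pairing X) (pairing Y)" using injp f(6) by (simp add: bij_betw_def)
  have colX: "P \<subseteq> pairing X" if "(i, P) \<in> col_verts (Psi D X)" for i P
    using that X.sigma_orbit(2) by (auto simp: Psi_def)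
  show ?thesis
    unfolding stacked_map_iso_def
  proof (intro exI conjI)
    show "bij_betw ((`) fv) (white_verts (Psi D X)) (white_verts (Psi D Y))"
      using bijp by (simp add: Psi_def)
    \<comment> \<open>The second component of a colored vertex is a set of pairs, hence a set of
      sets of vertices: \<open>fv\<close> acts on it by taking images twice.\<close>
    show "bij_betw (map_prod id ((`) ((`) fv))) (col_verts (Psi D X)) (col_verts (Psi D Y))"
    proof (rule bij_betw_imageI)
      show "inj_on (map_prod id ((`) ((`) fv))) (col_verts (Psi D X))"
      proof (rule inj_onI, clarsimp)
        fix i P Q
        assume "(i, P) \<in> col_verts (Psi D X)" "(i, Q) \<in> col_verts (Psi D X)"
          "(`) fv ` P = (`) fv ` Q"
        then show "P = Q" using colX[of i P] colX[of i Q] inj_on_image_eq_iff[OF injp, of P Q] by simp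
      qed
      show "map_prod id ((`) ((`) fv)) ` col_verts (Psi D X) = col_verts (Psi D Y)" (is "?L = ?R")
      proof
        show "?L \<subseteq> ?R"
        proof
          fix x assume "x \<in> ?L"
          then obtain i \<pi> where "i \<le> D" "\<pi> \<in> pairing X"
            "x = (i, (`) fv ` orbit (sigma X i) \<pi>)" by (auto simp: Psi_def)
          then have "x = (i, orbit (sigma Y i) (fv ` \<pi>))" "i \<le> D" "fv ` \<pi> \<in> pairing Y"
            using orb f(6) by auto
          then show "x \<in> ?R" by (auto simp: Psi_def)
        qed
        show "?R \<subseteq> ?L"
        proof
          fix x assume "x \<in> ?R"
          then obtain i \<pi> where "i \<le> D" "\<pi> \<in> pairing X"
            "x = (i, orbit (sigma Y i) (fv ` \<pi>))"
            unfolding Psi_def f(6)[symmetric] by auto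
          then have "(i, orbit (sigma X i) \<pi>) \<in> col_verts (Psi D X)"
            "x = map_prod id ((`) ((`) fv)) (i, orbit (sigma X i) \<pi>)"
            using orb by (auto simp: Psi_def)
          then show "x \<in> ?L" by blast
        qed
      qed
    qed
    show "bij_betw (map_prod id ((`) fv)) (map_edges (Psi D X)) (map_edges (Psi D Y))"
      using bij_betw_map_prod[OF bij_betw_id bijp] by (simp add: Psi_def)
    show "\<forall>c\<in>col_verts (Psi D X).
        vert_color (Psi D Y) (map_prod id ((`) ((`) fv)) c) = vert_color (Psi D X) c"
      by (simp add: Psi_def)
    show "\<forall>e\<in>map_edges (Psi D X).
       edge_color (Psi D Y) (map_prod id ((`) fv) e) = edge_color (Psi D X) e \<and>
       edge_white (Psi D Y) (map_prod id ((`) fv) e) = fv ` edge_white (Psi D X) e \<and>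
       edge_col (Psi D Y) (map_prod id ((`) fv) e) =
         map_prod id ((`) ((`) fv)) (edge_col (Psi D X) e) \<and>
       next_edge (Psi D Y) (map_prod id ((`) fv) e) = map_prod id ((`) fv) (next_edge (Psi D X) e)"
      using orb sig by (auto simp: Psi_def)
    have "map_prod (map_prod id ((`) fv)) (map_prod id ((`) fv)) (corner_of X e) = corner_of Y (fe e)"
      if "e \<in> edges X" for e
      using f(5)[OF that] pair X.edge_ends[OF that] by (simp add: corner_of_def)
    moreover have "marked_edges X \<subseteq> edges X"
      using X unfolding marked_paired_graph_def by auto
    ultimately show "map_prod (map_prod id ((`) fv)) (map_prod id ((`) fv)) ` marked_corners (Psi D X)
       = marked_corners (Psi D Y)"
      unfolding Psi_def f(7)[symmetric] stacked_map.simps image_image by (intro image_cong) auto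
  qed
qed

text \<open>
  A vertex is determined by its color and its pair, an edge by its color and the pair of its
  black end, so an isomorphism of the images, which is a bijection between the pairs
  commuting with the \<open>\<sigma>\<^sub>i\<close>, lifts to the vertices and to the edges.
\<close>

lemma stacked_map_iso_Psi_imp_paired_graph_iso:
  assumes X: "marked_paired_graph D q X" and Y: "marked_paired_graph D q Y"
    and iso: "stacked_map_iso (Psi D X) (Psi D Y)"
  shows "paired_graph_iso X Y"
proof -
  interpret X: paired_graph D X using X by (rule marked_paired_graph_imp_paired_graph)
  interpret Y: paired_graph D Y using Y by (rule marked_paired_graph_imp_paired_graph)
  obtain fw fc fe where f: "bij_betw fw (pairing X) (pairing Y)"
    "bij_betw fe ({..D} \<times> pairing X) ({..D} \<times> pairing Y)"
    "\<And>i \<pi>. i \<le> D \<Longrightarrow> \<pi> \<in> pairing X \<Longrightarrow> fst (fe (i, \<pi>)) = i \<and> snd (fe (i, \<pi>)) = fw \<pi> \<and>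
        next_edge (Psi D Y) (fe (i, \<pi>)) = fe (i, sigma X i \<pi>)"
    "map_prod fe fe ` marked_corners (Psi D X) = marked_corners (Psi D Y)"
    using iso unfolding stacked_map_iso_def by (auto simp: Psi_def)
  \<comment> \<open>An edge of \<open>Psi D Y\<close> consists of its color and its white vertex,
    both governed by the isomorphism. So \<open>fe\<close> carries no information beyond
    \<open>fw\<close>.\<close>
  have fe: "fe (i, \<pi>) = (i, fw \<pi>)" if "i \<le> D" "\<pi> \<in> pairing X" for i \<pi>
    using f(3)[OF that] by (simp add: prod_eq_iff)
  have sig: "sigma Y i (fw \<pi>) = fw (sigma X i \<pi>)" if "i \<le> D" "\<pi> \<in> pairing X" for i \<pi>
    using f(3)[OF that] fe[OF that] fe[OF that(1) X.sigma_in[OF that(2,1)]] by (simp add: Psi_def)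
  \<comment> \<open>Read the label in \<open>X\<close>, move its pair by \<open>fw\<close>, and
    decode the result in \<open>Y\<close>. The next definition does the same for edges.\<close>
  define gv where "gv = inv_into Y.vertices Y.vertex_label \<circ> map_prod id fw \<circ> X.vertex_label"
  define ge where "ge = inv_into (edges Y) Y.black_label \<circ> map_prod id fw \<circ> X.black_label"
  have bij_gv: "bij_betw gv X.vertices Y.vertices"
    unfolding gv_def
    by (rule bij_betw_trans[OF X.bij_vertex_label bij_betw_trans[OF
          bij_betw_map_prod[OF bij_betw_id f(1)] bij_betw_inv_into[OF Y.bij_vertex_label]],
          unfolded comp_assoc[symmetric]])
  have bij_ge: "bij_betw ge (edges X) (edges Y)"
    unfolding ge_def
    by (rule bij_betw_trans[OF X.bij_black_label bij_betw_trans[OF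
          bij_betw_map_prod[OF bij_betw_id f(1)] bij_betw_inv_into[OF Y.bij_black_label]],
          unfolded comp_assoc[symmetric]])
  have gv: "gv v \<in> Y.vertices" "gv v \<in> blacks Y \<longleftrightarrow> v \<in> blacks X" "pair_of Y (gv v) = fw (pair_of X v)"
    if "v \<in> X.vertices" for v
  proof -
    show "gv v \<in> Y.vertices" using that bij_gv bij_betwE by blast
    have "(v \<in> blacks X, fw (pair_of X v)) \<in> UNIV \<times> pairing Y"
      using X.pair_of(1)[OF that] f(1) bij_betwE by auto
    then have "Y.vertex_label (gv v) = (v \<in> blacks X, fw (pair_of X v))"
      using bij_betw_inv_into_right[OF Y.bij_vertex_label] by (simp add: gv_def)
    then show "gv v \<in> blacks Y \<longleftrightarrow> v \<in> blacks X" "pair_of Y (gv v) = fw (pair_of X v)" by auto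
  qed
  have ge: "ge e \<in> edges Y" "color Y (ge e) = color X e"
    "pair_of Y (black_end Y (ge e)) = fw (pair_of X (black_end X e))"
    if "e \<in> edges X" for e
  proof -
    show "ge e \<in> edges Y" using that bij_ge bij_betwE by blast
    have "(color X e, fw (pair_of X (black_end X e))) \<in> {..D} \<times> pairing Y"
      using X.pair_of(1) X.edge_ends[OF that] f(1) bij_betwE by fastforce
    then have "Y.black_label (ge e) = (color X e, fw (pair_of X (black_end X e)))"
      using bij_betw_inv_into_right[OF Y.bij_black_label] by (simp add: ge_def)
    then show "color Y (ge e) = color X e"
      "pair_of Y (black_end Y (ge e)) = fw (pair_of X (black_end X e))" by auto
  qed
  have image_color: "gv ` P = Q"
    if sub: "P \<subseteq> X.vertices" "Q \<subseteq> Y.vertices"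
      and iff: "\<And>v. v \<in> X.vertices \<Longrightarrow> gv v \<in> Q \<longleftrightarrow> v \<in> P" for P Q
  proof
    show "gv ` P \<subseteq> Q" using sub(1) iff by auto
    show "Q \<subseteq> gv ` P"
    proof
      fix u assume u: "u \<in> Q"
      then obtain v where "v \<in> X.vertices" "u = gv v"
        using sub(2) bij_betw_imp_surj_on[OF bij_gv] by blast
      then show "u \<in> gv ` P" using u iff by simp
    qed
  qed
  have "gv v \<in> whites Y \<longleftrightarrow> v \<in> whites X" if "v \<in> X.vertices" for v
    using gv(1,2)[OF that] X.disjoint[of v] Y.disjoint[of "gv v"] that by auto
  then have colors: "gv ` blacks X = blacks Y" "gv ` whites X = whites Y"
    using gv(2) image_color[of "blacks X" "blacks Y"] image_color[of "whites X" "whites Y"] by auto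
  \<comment> \<open>\<open>ge\<close> is built from black ends alone; the white ends follow because
    \<open>fw\<close> commutes with \<open>sigma\<close>.\<close>
  have white: "pair_of Y (white_end Y (ge e)) = fw (pair_of X (white_end X e))"
    if "e \<in> edges X" for e
    using Y.sigma_edge[OF ge(1)[OF that]] ge[OF that] X.sigma_edge[OF that] X.edge_ends[OF that]
      sig[OF X.edge_ends(3)[OF that], of "pair_of X (black_end X e)"] X.pair_of(1) by simp
  have ends: "black_end Y (ge e) = gv (black_end X e)" "white_end Y (ge e) = gv (white_end X e)"
    if e: "e \<in> edges X" for e
  proof -
    note * = X.edge_ends[OF e] Y.edge_ends[OF ge(1)[OF e]]
    show "black_end Y (ge e) = gv (black_end X e)"
      using * gv[of "black_end X e"] ge[OF e] by (intro Y.vertex_eqI) auto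
    show "white_end Y (ge e) = gv (white_end X e)"
      using * gv[of "white_end X e"] white[OF e] X.disjoint Y.disjoint by (intro Y.vertex_eqI) auto
  qed
  \<comment> \<open>A pair is the set of vertices whose \<open>pair_of\<close> it is, and
    \<open>gv\<close> moves \<open>pair_of\<close> by \<open>fw\<close>.\<close>
  have image_pair: "gv ` \<pi> = fw \<pi>" if p: "\<pi> \<in> pairing X" for \<pi>
  proof -
    have "fw \<pi> \<in> pairing Y" using p f(1) bij_betwE by blast
    then have "fw \<pi> = {u \<in> Y.vertices. pair_of Y u = fw \<pi>}" by (rule Y.pair_eq)
    also have "\<dots> = gv ` {v \<in> X.vertices. fw (pair_of X v) = fw \<pi>}"
      unfolding bij_betw_imp_surj_on[OF bij_gv, symmetric] using gv(3) by auto
    also have "{v \<in> X.vertices. fw (pair_of X v) = fw \<pi>} = {v \<in> X.vertices. pair_of X v = \<pi>}"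
      using inj_onD[OF bij_betw_imp_inj_on[OF f(1)]] X.pair_of(1) p by blast
    also have "\<dots> = \<pi>" using X.pair_eq[OF p] by simp
    finally show ?thesis by simp
  qed
  have mX: "marked_edges X \<subseteq> edges X" and mY: "marked_edges Y \<subseteq> edges Y"
    using X Y unfolding marked_paired_graph_def by auto
  have "map_prod fe fe (corner_of X e) = corner_of Y (ge e)" if "e \<in> edges X" for e
    using X.edge_ends[OF that] X.pair_of(1) ge[OF that] white[OF that]
    by (simp add: corner_of_def fe)
  then have "corner_of Y ` ge ` marked_edges X = map_prod fe fe ` corner_of X ` marked_edges X"
    unfolding image_image using mX by (intro image_cong) auto
  also have "\<dots> = corner_of Y ` marked_edges Y" using f(4) by (simp add: Psi_def)
  finally have "corner_of Y ` ge ` marked_edges X = corner_of Y ` marked_edges Y" .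
  moreover have "ge ` marked_edges X \<subseteq> edges Y" using mX ge(1) by blast
  \<comment> \<open>Distinct edges have distinct corners, so equal sets of marked corners come from
    equal sets of marked edges.\<close>
  ultimately have marks: "ge ` marked_edges X = marked_edges Y"
    using inj_on_image_eq_iff[OF Y.inj_corner_of _ mY] by blast
  have "(\<lambda>\<pi>. gv ` \<pi>) ` pairing X = pairing Y"
    using image_pair bij_betw_imp_surj_on[OF f(1)] by simp
  then show ?thesis
    unfolding paired_graph_iso_def using bij_gv bij_ge colors ends ge(2) marks
    by (intro exI[of _ gv] exI[of _ ge]) auto
qed

text \<open>A corner is identified with its first edge. Hence the edges of the map, renamed by
  \<open>ge\<close>, serve directly as the edges of the graph, and a mark moves along
  \<open>fst\<close>; \<open>gv\<close> names the two halves of each white vertex.\<close>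

lemma stacked_map_iso_Psi_exists:
  fixes \<Gamma> :: "('w, 'c, 'd) stacked_map"
  assumes "stacked_map D q \<Gamma>"
  obtains X :: "('v::infinite, 'e::infinite) paired_graph" where
    "marked_paired_graph D q X" "stacked_map_iso \<Gamma> (Psi D X)"
proof -
  interpret stacked D q \<Gamma> by standard fact
  obtain gv :: "'w \<times> bool \<Rightarrow> 'v" where gv: "inj_on gv (white_verts \<Gamma> \<times> UNIV)"
    using finite_inj_into_infinite[of "white_verts \<Gamma> \<times> (UNIV :: bool set)"] finite_white by auto
  obtain ge :: "'d \<Rightarrow> 'e" where ge: "inj_on ge (map_edges \<Gamma>)"
    using finite_inj_into_infinite[OF finite_map_edges] .
  define ed where "ed = inv_into (map_edges \<Gamma>) ge"
  define pr where "pr w = {gv (w, True), gv (w, False)}" for w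
  define X :: "('v, 'e) paired_graph" where "X =
    \<lparr> blacks = (\<lambda>w. gv (w, True)) ` white_verts \<Gamma>,
      whites = (\<lambda>w. gv (w, False)) ` white_verts \<Gamma>,
      edges = ge ` map_edges \<Gamma>,
      black_end = (\<lambda>e. gv (edge_white \<Gamma> (ed e), True)),
      white_end = (\<lambda>e. gv (edge_white \<Gamma> (next_edge \<Gamma> (ed e)), False)),
      color = (\<lambda>e. edge_color \<Gamma> (ed e)),
      pairing = pr ` white_verts \<Gamma>,
      marked_edges = ge ` fst ` marked_corners \<Gamma> \<rparr>"
  have ed: "ed (ge d) = d" if "d \<in> map_edges \<Gamma>" for d using ge that by (simp add: ed_def)
  have gv_eq: "gv (w, s) = gv (w', s') \<longleftrightarrow> w = w' \<and> s = s'"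
    if "w \<in> white_verts \<Gamma>" "w' \<in> white_verts \<Gamma>" for w w' s s'
    using inj_on_eq_iff[OF gv, of "(w, s)" "(w', s')"] that by simp
  have inj_pr: "inj_on pr (white_verts \<Gamma>)"
    by (rule inj_onI) (auto simp: pr_def doubleton_eq_iff gv_eq)
  have black_ex1: "\<exists>!e. e \<in> edges X \<and> color X e = i \<and> black_end X e = v"
    if v: "v \<in> blacks X" and i: "i \<le> D" for v i
  proof -
    obtain w where w: "w \<in> white_verts \<Gamma>" "v = gv (w, True)" using v by (auto simp: X_def)
    obtain d where d: "d \<in> map_edges \<Gamma>" "edge_color \<Gamma> d = i" "edge_white \<Gamma> d = w"
      using edge_cases[OF w(1) i] .
    show ?thesis
    proof (rule ex1I[of _ "ge d"])
      show "ge d \<in> edges X \<and> color X (ge d) = i \<and> black_end X (ge d) = v"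
        using d w by (simp add: X_def ed)
      fix e assume "e \<in> edges X \<and> color X e = i \<and> black_end X e = v"
      then obtain d' where d': "d' \<in> map_edges \<Gamma>" "e = ge d'" "edge_color \<Gamma> d' = i"
        "edge_white \<Gamma> d' = w" using w edge_white_in by (auto simp: X_def ed gv_eq)
      then show "e = ge d" using d edge_eqI[of d' d] by simp
    qed
  qed
  have white_ex1: "\<exists>!e. e \<in> edges X \<and> color X e = i \<and> white_end X e = v"
    if v: "v \<in> whites X" and i: "i \<le> D" for v i
  proof -
    obtain w where w: "w \<in> white_verts \<Gamma>" "v = gv (w, False)" using v by (auto simp: X_def)
    obtain d0 where d0: "d0 \<in> map_edges \<Gamma>" "edge_color \<Gamma> d0 = i" "edge_white \<Gamma> d0 = w"
      using edge_cases[OF w(1) i] .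
    \<comment> \<open>The graph edge that ends at the white half of \<open>w\<close> is the corner
      whose second edge is \<open>d0\<close>, so its name is the predecessor of
      \<open>d0\<close>.\<close>
    have "d0 \<in> next_edge \<Gamma> ` map_edges \<Gamma>"
      using endo_inj_surj[OF finite_map_edges _ inj_next_edge] next_edge(1) d0(1) by blast
    then obtain d where d: "d \<in> map_edges \<Gamma>" "d0 = next_edge \<Gamma> d" by auto
    show ?thesis
    proof (rule ex1I[of _ "ge d"])
      show "ge d \<in> edges X \<and> color X (ge d) = i \<and> white_end X (ge d) = v"
        using d d0 w next_edge by (simp add: X_def ed)
      fix e assume "e \<in> edges X \<and> color X e = i \<and> white_end X e = v"
      then obtain d' where d': "d' \<in> map_edges \<Gamma>" "e = ge d'" "edge_color \<Gamma> d' = i"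
        "edge_white \<Gamma> (next_edge \<Gamma> d') = w"
        using w edge_white_in next_edge by (auto simp: X_def ed gv_eq)
      then have "next_edge \<Gamma> d' = next_edge \<Gamma> d"
        using d d0 next_edge edge_eqI[of "next_edge \<Gamma> d'" d0] by simp
      then show "e = ge d" using d d' inj_onD[OF inj_next_edge, of d' d] by simp
    qed
  qed
  have graph: "colored_graph D X"
    unfolding colored_graph_def
  proof (intro conjI)
    show "finite (blacks X)" "finite (whites X)" "finite (edges X)"
      using finite_white finite_map_edges by (simp_all add: X_def)
    show "blacks X \<inter> whites X = {}" by (auto simp: X_def gv_eq)
    show "\<forall>e\<in>edges X. black_end X e \<in> blacks X \<and> white_end X e \<in> whites X \<and> color X e \<le> D"
      using edge_white_in edge_color_le next_edge by (auto simp: X_def ed)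
  qed (use black_ex1 white_ex1 in blast)+
  have "is_pairing X (pairing X)"
    unfolding is_pairing_def
  proof
    show "partition_on (blacks X \<union> whites X) (pairing X)"
      by (rule partition_onI) (auto simp: X_def pr_def gv_eq disjnt_def)
    show "\<forall>\<pi>\<in>pairing X. \<exists>b\<in>blacks X. \<exists>w\<in>whites X. \<pi> = {b, w}"
      by (auto simp: X_def pr_def)
  qed
  with graph interpret X: paired_graph D X by unfold_locales
  have pair_gv: "pair_of X (gv (w, s)) = pr w" if "w \<in> white_verts \<Gamma>" for w s
    by (rule X.pair_of_eq) (use that in \<open>cases s; auto simp: X_def pr_def\<close>)+
  have sig: "sigma X (edge_color \<Gamma> d) (pr (edge_white \<Gamma> d)) = pr (edge_white \<Gamma> (next_edge \<Gamma> d))"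
    if d: "d \<in> map_edges \<Gamma>" for d
  proof -
    have "ge d \<in> edges X" using d by (simp add: X_def)
    from X.sigma_edge[OF this] have
      "sigma X (edge_color \<Gamma> d) (pair_of X (gv (edge_white \<Gamma> d, True))) =
        pair_of X (gv (edge_white \<Gamma> (next_edge \<Gamma> d), False))"
      using d by (simp add: X_def ed)
    then show ?thesis using d next_edge edge_white_in by (simp add: pair_gv)
  qed
  \<comment> \<open>The pairs around the colored vertex \<open>c\<close>. They form the orbit that
    names the matching vertex of \<open>Psi D X\<close>.\<close>
  let ?star = "\<lambda>c. (\<lambda>d. pr (edge_white \<Gamma> d)) ` {e \<in> map_edges \<Gamma>. edge_col \<Gamma> e = c}"
  have orb: "orbit (sigma X (edge_color \<Gamma> d)) (pr (edge_white \<Gamma> d)) = ?star (edge_col \<Gamma> d)"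
    if d: "d \<in> map_edges \<Gamma>" for d
  proof -
    let ?S = "{e \<in> map_edges \<Gamma>. edge_col \<Gamma> e = edge_col \<Gamma> d}"
    have "orbit (sigma X (edge_color \<Gamma> d)) (pr (edge_white \<Gamma> d)) =
      (\<lambda>d. pr (edge_white \<Gamma> d)) ` orbit (next_edge \<Gamma>) d"
    proof (rule orbit_conj[where A = ?S])
      fix e assume e: "e \<in> ?S"
      then have "edge_color \<Gamma> e = edge_color \<Gamma> d" using d edge_color by simp
      then show "pr (edge_white \<Gamma> (next_edge \<Gamma> e)) = sigma X (edge_color \<Gamma> d) (pr (edge_white \<Gamma> e))"
        using sig[of e] e by simp
    qed (use d next_edge in auto)
    also have "orbit (next_edge \<Gamma>) d = ?S"
      using orbit_cyclic_eq3[OF cyclic[OF edge_col_in[OF d]]] d by simp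
    finally show ?thesis .
  qed
  \<comment> \<open>Vertices of the same color whose stars share a pair coincide, because a white
    vertex has a single edge of that color.\<close>
  have star_inj: "edge_col \<Gamma> d = edge_col \<Gamma> d'"
    if star: "d \<in> map_edges \<Gamma>" "d' \<in> map_edges \<Gamma>" "edge_color \<Gamma> d = edge_color \<Gamma> d'"
      "?star (edge_col \<Gamma> d) = ?star (edge_col \<Gamma> d')" for d d'
  proof -
    have "pr (edge_white \<Gamma> d) \<in> ?star (edge_col \<Gamma> d)" using star(1) by blast
    then obtain e where e: "e \<in> map_edges \<Gamma>" "edge_col \<Gamma> e = edge_col \<Gamma> d'"
      "pr (edge_white \<Gamma> d) = pr (edge_white \<Gamma> e)" unfolding star(4) by auto
    then have "edge_white \<Gamma> d = edge_white \<Gamma> e"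
      using inj_onD[OF inj_pr] edge_white_in star by blast
    moreover have "edge_color \<Gamma> d = edge_color \<Gamma> e" using e star edge_color by simp
    ultimately have "d = e" using e star by (intro edge_eqI)
    then show ?thesis using e by simp
  qed
  have marked_ge: "marked_edges X = (\<lambda>(d, d'). ge d) ` marked_corners \<Gamma>"
    by (auto simp: X_def image_image case_prod_unfold)
  have black_pair: "pair_of X (black_end X (ge d)) = pr (edge_white \<Gamma> d)"
    and white_pair: "pair_of X (white_end X (ge d)) = pr (edge_white \<Gamma> (next_edge \<Gamma> d))"
    if "d \<in> map_edges \<Gamma>" for d
    using that edge_white_in pair_gv[of "edge_white \<Gamma> d" True] next_edge
      pair_gv[of "edge_white \<Gamma> (next_edge \<Gamma> d)" False] by (simp_all add: X_def ed)
  \<comment> \<open>Injectivity of the composite serves twice: its outer part gives at most one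
    marked edge per cycle, its inner part the number of marked edges.\<close>
  have inj_orb: "inj_on ((\<lambda>e. orbit (sigma X 0) (pair_of X (black_end X e))) \<circ> (\<lambda>(d, d'). ge d))
    (marked_corners \<Gamma>)"
  proof (rule inj_onI)
    fix x y assume x: "x \<in> marked_corners \<Gamma>" and y: "y \<in> marked_corners \<Gamma>"
      and eq: "((\<lambda>e. orbit (sigma X 0) (pair_of X (black_end X e))) \<circ> (\<lambda>(d, d'). ge d)) x =
        ((\<lambda>e. orbit (sigma X 0) (pair_of X (black_end X e))) \<circ> (\<lambda>(d, d'). ge d)) y"
    obtain d where d: "x = (d, next_edge \<Gamma> d)" "d \<in> map_edges \<Gamma>" "edge_color \<Gamma> d = 0"
      using x marked by auto
    obtain d' where d': "y = (d', next_edge \<Gamma> d')" "d' \<in> map_edges \<Gamma>" "edge_color \<Gamma> d' = 0"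
      using y marked by auto
    have "orbit (sigma X 0) (pr (edge_white \<Gamma> d)) = orbit (sigma X 0) (pr (edge_white \<Gamma> d'))"
      using eq d d' by (simp add: black_pair)
    then have "?star (edge_col \<Gamma> d) = ?star (edge_col \<Gamma> d')"
      using orb[OF d(2)] orb[OF d'(2)] d(3) d'(3) by simp
    then have "edge_col \<Gamma> d = edge_col \<Gamma> d'" using d d' by (intro star_inj) auto
    then show "x = y" using inj_onD[OF inj_marked _ x y] d d' by simp
  qed
  have X: "marked_paired_graph D q X"
    unfolding marked_paired_graph_def
  proof (intro conjI)
    show "colored_graph D X" "is_pairing X (pairing X)" by fact+
    show "marked_edges X \<subseteq> {e \<in> edges X. color X e = 0}"
      using marked by (auto simp: X_def ed)
    show "inj_on (\<lambda>e. orbit (sigma X 0) (pair_of X (black_end X e))) (marked_edges X)"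
      unfolding marked_ge using inj_orb by (rule inj_on_imageI)
    show "card (marked_edges X) = q"
      unfolding marked_ge using inj_on_imageI2[OF inj_orb] by (simp add: card_image card_marked)
  qed
  have "stacked_map_iso \<Gamma> (Psi D X)"
    unfolding stacked_map_iso_def
  proof (intro exI conjI)
    let ?fe = "\<lambda>d. (edge_color \<Gamma> d, pr (edge_white \<Gamma> d))"
    let ?fc = "\<lambda>c. (vert_color \<Gamma> c, ?star c)"
    show "bij_betw pr (white_verts \<Gamma>) (white_verts (Psi D X))"
      using inj_pr by (simp add: bij_betw_def Psi_def X_def)
    have fc: "?fc (edge_col \<Gamma> d) = edge_col (Psi D X) (?fe d)" if "d \<in> map_edges \<Gamma>" for d
      using orb[OF that] edge_color[OF that] by (simp add: Psi_def)
    show bij_fe: "bij_betw ?fe (map_edges \<Gamma>) (map_edges (Psi D X))"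
    proof (rule bij_betw_imageI)
      show "inj_on ?fe (map_edges \<Gamma>)"
        using edge_eqI inj_onD[OF inj_pr] edge_white_in by (intro inj_onI) simp
      show "?fe ` map_edges \<Gamma> = map_edges (Psi D X)"
      proof
        show "?fe ` map_edges \<Gamma> \<subseteq> map_edges (Psi D X)"
          using edge_color_le edge_white_in by (auto simp: Psi_def X_def)
        show "map_edges (Psi D X) \<subseteq> ?fe ` map_edges \<Gamma>"
        proof
          fix x assume "x \<in> map_edges (Psi D X)"
          then obtain i w where x: "x = (i, pr w)" "i \<le> D" "w \<in> white_verts \<Gamma>"
            by (auto simp: Psi_def X_def)
          obtain d where "d \<in> map_edges \<Gamma>" "edge_color \<Gamma> d = i" "edge_white \<Gamma> d = w"
            using edge_cases[OF x(3,2)] .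
          then show "x \<in> ?fe ` map_edges \<Gamma>" using x by blast
        qed
      qed
    qed
    show "bij_betw ?fc (col_verts \<Gamma>) (col_verts (Psi D X))"
    proof (rule bij_betw_imageI)
      show "inj_on ?fc (col_verts \<Gamma>)"
      proof (rule inj_onI)
        fix c c' assume c: "c \<in> col_verts \<Gamma>" "c' \<in> col_verts \<Gamma>" "?fc c = ?fc c'"
        obtain d where d: "d \<in> map_edges \<Gamma>" "edge_col \<Gamma> d = c" using edge_at_col[OF c(1)] .
        obtain d' where d': "d' \<in> map_edges \<Gamma>" "edge_col \<Gamma> d' = c'" using edge_at_col[OF c(2)] .
        show "c = c'" using star_inj[OF d(1) d'(1)] c(3) d d' edge_color by simp
      qed
      \<comment> \<open>No colored vertex is isolated, so on both sides the colored vertices are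
        seen from the edges, and surjectivity reduces to the compatibility
        \<open>fc\<close>.\<close>
      have cols: "col_verts \<Gamma> = edge_col \<Gamma> ` map_edges \<Gamma>"
        using edge_col_in edge_at_col by blast
      have colsX: "col_verts (Psi D X) = edge_col (Psi D X) ` map_edges (Psi D X)"
        by (auto simp: Psi_def)
      show "?fc ` col_verts \<Gamma> = col_verts (Psi D X)"
        unfolding cols colsX bij_betw_imp_surj_on[OF bij_fe, symmetric] image_image
        using fc by (rule image_cong[OF refl])
    qed
    show "\<forall>c\<in>col_verts \<Gamma>. vert_color (Psi D X) (?fc c) = vert_color \<Gamma> c"
      by (simp add: Psi_def)
    show "\<forall>e\<in>map_edges \<Gamma>. edge_color (Psi D X) (?fe e) = edge_color \<Gamma> e \<and>
        edge_white (Psi D X) (?fe e) = pr (edge_white \<Gamma> e) \<and>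
        edge_col (Psi D X) (?fe e) = ?fc (edge_col \<Gamma> e) \<and>
        next_edge (Psi D X) (?fe e) = ?fe (next_edge \<Gamma> e)"
    proof (intro ballI conjI)
      fix d assume "d \<in> map_edges \<Gamma>"
      then show "edge_col (Psi D X) (?fe d) = ?fc (edge_col \<Gamma> d)"
        "next_edge (Psi D X) (?fe d) = ?fe (next_edge \<Gamma> d)"
        using fc sig next_edge by (simp_all add: Psi_def)
    qed (simp_all add: Psi_def)
    have "map_prod ?fe ?fe x = corner_of X ((\<lambda>(d, d'). ge d) x)" if "x \<in> marked_corners \<Gamma>" for x
    proof -
      obtain d where d: "x = (d, next_edge \<Gamma> d)" "d \<in> map_edges \<Gamma>" using marked \<open>x \<in> _\<close> by auto
      have "color X (ge d) = edge_color \<Gamma> d" using d by (simp add: X_def ed)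
      then show ?thesis using d next_edge by (simp add: corner_of_def black_pair white_pair)
    qed
    then show "map_prod ?fe ?fe ` marked_corners \<Gamma> = marked_corners (Psi D X)"
      by (simp add: Psi_def marked_ge image_image cong: image_cong)
  qed
  then show ?thesis using that X by blast
qed

section \<open>Bicolored cycles and faces\<close>

locale bicolored_paired_graph = paired_graph +
  fixes i j :: nat
  assumes less: "i < j" and le: "j \<le> D"
begin

definition edge_at :: "nat \<Rightarrow> 'a \<Rightarrow> 'b" where
  "edge_at c v = (THE e. e \<in> edges X \<and> color X e = c \<and>
     (if v \<in> blacks X then black_end X e else white_end X e) = v)"

text \<open>For fixed \<open>c\<close> this is an involution of the vertices that exchanges the two
  vertex colors. The bicolored components are the orbits of the group generated by the involutions
  for \<open>i\<close> and \<open>j\<close>.\<close>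

definition opposite :: "nat \<Rightarrow> 'a \<Rightarrow> 'a" where
  "opposite c v = (if v \<in> blacks X then white_end X (edge_at c v) else black_end X (edge_at c v))"

definition other_color :: "nat \<Rightarrow> nat" where
  "other_color c = (if c = i then j else i)"

text \<open>
  Tracing a face of the twisted submap amounts to travelling along a bicolored cycle of the
  graph. The state \<open>departure c v\<close> is the departure from the vertex \<open>v\<close> along its edge of
  color \<open>c\<close>, and \<open>arrival c v\<close> is the arrival at \<open>v\<close> along that edge; every state has one
  of these forms. The orientation bit records on which side of the pair of \<open>v\<close> we are.
\<close>

definition departure :: "nat \<Rightarrow> 'a \<Rightarrow> ((nat \<times> 'a set) \<times> edge_end) \<times> bool" where
  "departure c v = (((c, pair_of X v), White_End), c = i \<longleftrightarrow> v \<in> whites X)"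

definition arrival :: "nat \<Rightarrow> 'a \<Rightarrow> ((nat \<times> 'a set) \<times> edge_end) \<times> bool" where
  "arrival c v = (((c, pair_of X v), Colored_End), v \<in> whites X)"

definition edge_corner ::
  "'b \<Rightarrow> ((nat \<times> 'a set) \<times> edge_end) \<times> ((nat \<times> 'a set) \<times> edge_end)" where
  "edge_corner e = ((fst (corner_of X e), Colored_End), (snd (corner_of X e), Colored_End))"

text \<open>The two corners at a white vertex of the submap stand for the two vertices of the pair.\<close>

definition vertex_corner ::
  "'a \<Rightarrow> ((nat \<times> 'a set) \<times> edge_end) \<times> ((nat \<times> 'a set) \<times> edge_end)" where
  "vertex_corner v = (if v \<in> blacks X
     then (((i, pair_of X v), White_End), ((j, pair_of X v), White_End))
     else (((j, pair_of X v), White_End), ((i, pair_of X v), White_End)))"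

abbreviation "submap \<equiv> twisted_submap (Psi D X) i j"

abbreviation "corner \<equiv> turn_corner submap \<circ> cross_edge submap"

lemma other_color [simp]:
  "other_color i = j" "other_color j = i"
  "c \<in> {i, j} \<Longrightarrow> other_color (other_color c) = c" "other_color c \<in> {i, j}"
  using less by (auto simp: other_color_def)

lemma other_color_eq: "c \<in> {i, j} \<Longrightarrow> d \<in> {i, j} \<Longrightarrow> c \<noteq> d \<Longrightarrow> c = other_color d"
  by (auto simp: other_color_def)

lemma color_le: "c \<in> {i, j} \<Longrightarrow> c \<le> D"
  using less le by auto

section \<open>Bicolored adjacency through two involutions\<close>

lemma edge_at_ex1:
  assumes "v \<in> vertices" "c \<in> {i, j}"
  shows "\<exists>!e. e \<in> edges X \<and> color X e = c \<and>
     (if v \<in> blacks X then black_end X e else white_end X e) = v"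
  using assms black_ex1[OF _ color_le] white_ex1[OF _ color_le] disjoint by (cases "v \<in> blacks X") auto

lemma edge_at:
  assumes "v \<in> vertices" "c \<in> {i, j}"
  shows "edge_at c v \<in> edges X" "color X (edge_at c v) = c"
    "v \<in> blacks X \<Longrightarrow> black_end X (edge_at c v) = v"
    "v \<in> whites X \<Longrightarrow> white_end X (edge_at c v) = v"
  using theI'[OF edge_at_ex1[OF assms]] disjoint unfolding edge_at_def by (auto split: if_splits)

lemma edge_at_eq:
  assumes "e \<in> edges X" "color X e \<in> {i, j}"
  shows "edge_at (color X e) (black_end X e) = e" "edge_at (color X e) (white_end X e) = e"
proof -
  note ends = edge_ends[OF assms(1)]
  note b = edge_at[of "black_end X e", OF _ assms(2)]
  note w = edge_at[of "white_end X e", OF _ assms(2)]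
  show "edge_at (color X e) (black_end X e) = e"
    using ends assms b by (intro edge_eqI(1)) auto
  show "edge_at (color X e) (white_end X e) = e"
    using ends assms w by (intro edge_eqI(2)) auto
qed

lemma opposite:
  assumes "v \<in> vertices" "c \<in> {i, j}"
  shows "opposite c v \<in> vertices" "opposite c v \<in> blacks X \<longleftrightarrow> v \<in> whites X"
    "opposite c v \<in> whites X \<longleftrightarrow> v \<in> blacks X"
    "edge_at c (opposite c v) = edge_at c v" "opposite c (opposite c v) = v"
proof -
  note e = edge_at[OF assms]
  note ends = edge_ends[OF e(1)]
  note eq = edge_at_eq[OF e(1), unfolded e(2), OF assms(2)]
  show "opposite c v \<in> vertices" "opposite c v \<in> blacks X \<longleftrightarrow> v \<in> whites X"
    "opposite c v \<in> whites X \<longleftrightarrow> v \<in> blacks X"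
    using assms(1) ends disjoint[of v] disjoint[of "black_end X (edge_at c v)"]
      disjoint[of "white_end X (edge_at c v)"] by (auto simp: opposite_def)
  show at: "edge_at c (opposite c v) = edge_at c v"
    using eq by (simp add: opposite_def)
  show "opposite c (opposite c v) = v"
    using at assms(1) ends e(3,4) disjoint[of "white_end X (edge_at c v)"]
    by (auto simp: opposite_def)
qed

lemma bicolored_adj_iff:
  "(u, v) \<in> bicolored_adj X i j \<longleftrightarrow> u \<in> vertices \<and> (\<exists>c\<in>{i, j}. v = opposite c u)"
proof
  assume "(u, v) \<in> bicolored_adj X i j"
  then obtain e where e: "e \<in> edges X" "color X e \<in> {i, j}"
    "u = black_end X e \<and> v = white_end X e \<or> u = white_end X e \<and> v = black_end X e"
    by (auto simp: bicolored_adj_def bicolored_edges_def doubleton_eq_iff)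
  have "v = opposite (color X e) u" "u \<in> vertices"
    using e(3) edge_at_eq[OF e(1,2)] edge_ends[OF e(1)] disjoint[of "white_end X e"]
    by (auto simp: opposite_def)
  then show "u \<in> vertices \<and> (\<exists>c\<in>{i, j}. v = opposite c u)" using e(2) by blast
next
  assume "u \<in> vertices \<and> (\<exists>c\<in>{i, j}. v = opposite c u)"
  then obtain c where c: "u \<in> vertices" "c \<in> {i, j}" "v = opposite c u" by blast
  note e = edge_at[OF c(1,2)]
  have "edge_at c u \<in> bicolored_edges X i j" using e c(2) by (auto simp: bicolored_edges_def)
  moreover have "{u, v} = {black_end X (edge_at c u), white_end X (edge_at c u)}"
    using c(1,3) e(3,4) by (auto simp: opposite_def)
  ultimately show "(u, v) \<in> bicolored_adj X i j" by (auto simp: bicolored_adj_def)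
qed

lemma sigma_opposite:
  assumes "v \<in> vertices" "c \<in> {i, j}"
  shows "v \<in> blacks X \<Longrightarrow> sigma X c (pair_of X v) = pair_of X (opposite c v)"
    "v \<in> whites X \<Longrightarrow> sigma X c (pair_of X (opposite c v)) = pair_of X v"
  using sigma_edge[OF edge_at(1)[OF assms]] edge_at[OF assms] disjoint[of v]
  by (auto simp: opposite_def)

section \<open>The twisted submap: half-edges and rotation\<close>

lemma half_edges_submap: "half_edges submap = ({i, j} \<times> pairing X) \<times> UNIV"
  using less le by (auto simp: twisted_submap_def bicolored_submap_def Psi_def)

lemma rot_colored: "rot submap ((c, \<pi>), Colored_End) = ((c, sigma X c \<pi>), Colored_End)"
  by (simp add: twisted_submap_def bicolored_submap_def Psi_def)

lemma rot_white:
  assumes "\<pi> \<in> pairing X" "c \<in> {i, j}"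
  shows "rot submap ((c, \<pi>), White_End) = ((other_color c, \<pi>), White_End)"
proof -
  have "other_edge (Psi D X) i j (c, \<pi>) = (other_color c, \<pi>)"
    unfolding other_edge_def
    by (rule the_equality) (use assms less le in \<open>auto simp: Psi_def other_color_def\<close>)
  then show ?thesis by (simp add: twisted_submap_def bicolored_submap_def)
qed

lemma inj_rot: "inj_on (rot submap) (half_edges submap)"
proof (rule inj_onI)
  fix x y assume *: "x \<in> half_edges submap" "y \<in> half_edges submap" "rot submap x = rot submap y"
  obtain c \<pi> s where x: "x = ((c, \<pi>), s)" "c \<in> {i, j}" "\<pi> \<in> pairing X"
    using *(1) unfolding half_edges_submap by blast
  obtain d \<rho> t where y: "y = ((d, \<rho>), t)" "d \<in> {i, j}" "\<rho> \<in> pairing X"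
    using *(2) unfolding half_edges_submap by blast
  have "inj_on (sigma X c) (pairing X)" using inj_sigma color_le x(2) by blast
  moreover have "other_color c = other_color d \<longleftrightarrow> c = d" using x(2) y(2) other_color(3) by metis
  ultimately show "x = y" using *(3) x y
    by (cases s; cases t) (auto simp: rot_colored rot_white dest: inj_onD)
qed

lemma rot_inv_rot: "h \<in> half_edges submap \<Longrightarrow> rot_inv submap (rot submap h) = h"
  unfolding rot_inv_def using inj_rot by (rule inv_into_f_f)

lemma rot_inv_colored:
  "\<pi> \<in> pairing X \<Longrightarrow> c \<in> {i, j} \<Longrightarrow>
    rot_inv submap ((c, sigma X c \<pi>), Colored_End) = ((c, \<pi>), Colored_End)"
  using rot_inv_rot[of "((c, \<pi>), Colored_End)"] by (simp add: half_edges_submap rot_colored)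

text \<open>White vertices have valency two in the submap, so turning in either sense reaches the
  same half-edge. Only the corner passed depends on the orientation.\<close>

lemma rot_inv_white:
  "\<pi> \<in> pairing X \<Longrightarrow> c \<in> {i, j} \<Longrightarrow>
    rot_inv submap ((c, \<pi>), White_End) = ((other_color c, \<pi>), White_End)"
  using rot_inv_rot[of "((other_color c, \<pi>), White_End)"] rot_white[of \<pi> "other_color c"]
    other_color(4)[of c] by (simp add: half_edges_submap)

text \<open>The orientation bit of \<open>departure\<close> depends on the color in order to absorb
  the twist: after crossing, the bit is the same for \<open>i\<close> and \<open>j\<close>, and
  holds exactly when \<open>v\<close> is black (for a vertex \<open>v\<close>).\<close>

lemma cross_edge_departure:
  assumes "c \<in> {i, j}"
  shows "cross_edge submap (departure c v) = (((c, pair_of X v), Colored_End), v \<notin> whites X)"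
  using assms less
  by (auto simp: cross_edge_def departure_def twisted_submap_def bicolored_submap_def Psi_def)

text \<open>The resulting bit is written as the one that a departure along the other color
  requires.\<close>

lemma cross_edge_arrival:
  assumes "c \<in> {i, j}"
  shows "cross_edge submap (arrival c v) =
    (((c, pair_of X v), White_End), other_color c = i \<longleftrightarrow> v \<in> whites X)"
  using assms less
  by (auto simp: cross_edge_def arrival_def twisted_submap_def bicolored_submap_def Psi_def)

text \<open>From a black \<open>v\<close> the turn follows \<open>\<sigma>\<^sub>c\<close>, from a
  white \<open>v\<close> its inverse. Both travel along the same edge and pass the same corner, so
  the corner does not depend on the direction.\<close>

lemma face_step_departure:
  assumes "v \<in> vertices" "c \<in> {i, j}"
  shows "face_step submap (departure c v) = arrival c (opposite c v)"
    "corner (departure c v) = edge_corner (edge_at c v)"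
proof -
  note o = opposite[OF assms] sigma_opposite[OF assms]
  note e = edge_at[OF assms]
  have p: "pair_of X v \<in> pairing X" "pair_of X (opposite c v) \<in> pairing X"
    using pair_of(1) assms o(1) by auto
  show "face_step submap (departure c v) = arrival c (opposite c v)"
  proof (cases "v \<in> whites X")
    case True
    then show ?thesis
      using o disjoint[of v] rot_inv_colored[OF p(2) assms(2)]
      by (auto simp: face_step_def cross_edge_departure[OF assms(2)] turn_def arrival_def)
  next
    case False
    then show ?thesis
      using o assms(1)
      by (auto simp: face_step_def cross_edge_departure[OF assms(2)] turn_def arrival_def rot_colored)
  qed
  show "corner (departure c v) = edge_corner (edge_at c v)"
  proof (cases "v \<in> whites X")
    case True
    then have "v \<notin> blacks X" using disjoint by blast
    then show ?thesis
      using True o e rot_inv_colored[OF p(2) assms(2)]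
      by (auto simp: cross_edge_departure[OF assms(2)] turn_corner_def edge_corner_def
          corner_of_def opposite_def)
  next
    case False
    then show ?thesis
      using o e assms(1)
      by (auto simp: cross_edge_departure[OF assms(2)] turn_corner_def rot_colored edge_corner_def
          corner_of_def opposite_def)
  qed
qed

text \<open>The arrivals at \<open>v\<close> along the two colors differ in the half-edge and in the
  orientation, and the two differences cancel in the corner passed.\<close>

lemma face_step_arrival:
  assumes "v \<in> vertices" "c \<in> {i, j}"
  shows "face_step submap (arrival c v) = departure (other_color c) v"
    "corner (arrival c v) = vertex_corner v"
proof -
  have p: "pair_of X v \<in> pairing X" using pair_of(1) assms by auto
  show "face_step submap (arrival c v) = departure (other_color c) v"
    by (simp add: face_step_def cross_edge_arrival[OF assms(2)] turn_def departure_def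
        rot_white[OF p assms(2)] rot_inv_white[OF p assms(2)])
  show "corner (arrival c v) = vertex_corner v"
    using assms less disjoint[of v]
    by (auto simp: cross_edge_arrival[OF assms(2)] turn_corner_def vertex_corner_def
        rot_white[OF p assms(2)] rot_inv_white[OF p assms(2)] other_color_def)
qed

text \<open>The bit prescribes the color of \<open>v\<close> within the pair of the half-edge, and
  every pair has a vertex of either color.\<close>

lemma state_cases:
  assumes "h \<in> half_edges submap"
  obtains c v where "c \<in> {i, j}" "v \<in> vertices" "(h, s) = departure c v \<or> (h, s) = arrival c v"
proof -
  obtain c \<pi> t where h: "h = ((c, \<pi>), t)" "c \<in> {i, j}" "\<pi> \<in> pairing X"
    using assms unfolding half_edges_submap by blast
  show ?thesis
  proof (cases t)
    case White_End
    obtain v where v: "v \<in> vertices" "v \<in> blacks X \<longleftrightarrow> (c = i \<longleftrightarrow> \<not> s)" "pair_of X v = \<pi>"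
      using vertex_cases[OF h(3)] .
    then have "(h, s) = departure c v"
      using h(1) White_End disjoint[of v] by (auto simp: departure_def)
    then show ?thesis using that h v by blast
  next
    case Colored_End
    obtain v where v: "v \<in> vertices" "v \<in> blacks X \<longleftrightarrow> \<not> s" "pair_of X v = \<pi>"
      using vertex_cases[OF h(3)] .
    then have "(h, s) = arrival c v"
      using h(1) Colored_End disjoint[of v] by (auto simp: arrival_def)
    then show ?thesis using that h v by blast
  qed
qed

section \<open>Orbits of face tracing\<close>

lemma departure_in: "v \<in> vertices \<Longrightarrow> c \<in> {i, j} \<Longrightarrow> departure c v \<in> half_edges submap \<times> UNIV"
  and arrival_in: "v \<in> vertices \<Longrightarrow> c \<in> {i, j} \<Longrightarrow> arrival c v \<in> half_edges submap \<times> UNIV"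
  unfolding half_edges_submap departure_def arrival_def using pair_of(1) by auto

lemma finite_states: "finite (half_edges submap \<times> (UNIV :: bool set))"
proof -
  have "(UNIV :: edge_end set) = {White_End, Colored_End}" using edge_end.exhaust by auto
  then have "finite (UNIV :: edge_end set)" by (metis finite.intros)
  then show ?thesis unfolding half_edges_submap using finite_pairing by auto
qed

text \<open>Surjectivity is seen by going one step back: a departure is preceded by the arrival
  along the other color, an arrival by the departure from the opposite vertex. Finiteness then gives
  injectivity.\<close>

lemma face_step_states: "face_step submap ` (half_edges submap \<times> UNIV) = half_edges submap \<times> UNIV"
  (is "_ ` ?S = ?S")
proof
  have cases: "\<exists>c\<in>{i, j}. \<exists>v\<in>vertices. x = departure c v \<or> x = arrival c v" if "x \<in> ?S" for x
    using that state_cases[of "fst x" "snd x"] by (metis mem_Times_iff prod.collapse)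
  show "face_step submap ` ?S \<subseteq> ?S"
  proof (rule image_subsetI)
    fix x assume "x \<in> ?S"
    then obtain c v where c: "c \<in> {i, j}" and v: "v \<in> vertices"
      and x: "x = departure c v \<or> x = arrival c v"
      using cases by blast
    from x show "face_step submap x \<in> ?S"
      using face_step_departure(1)[OF v c] face_step_arrival(1)[OF v c]
        arrival_in[OF opposite(1)[OF v c] c] departure_in[OF v other_color(4)[of c]] by auto
  qed
  show "?S \<subseteq> face_step submap ` ?S"
  proof
    fix x assume "x \<in> ?S"
    then obtain c v where c: "c \<in> {i, j}" and v: "v \<in> vertices"
      and x: "x = departure c v \<or> x = arrival c v"
      using cases by blast
    have "departure c v = face_step submap (arrival (other_color c) v)"
      using face_step_arrival(1)[OF v other_color(4)[of c]] other_color(3)[OF c] by simp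
    moreover have "arrival c v = face_step submap (departure c (opposite c v))"
      using face_step_departure(1)[OF opposite(1)[OF v c] c] opposite(5)[OF v c] by simp
    moreover note x arrival_in[OF v other_color(4)[of c]] departure_in[OF opposite(1)[OF v c] c]
    ultimately show "x \<in> face_step submap ` ?S" by (metis image_eqI)
  qed
qed

lemma inj_face_step: "inj_on (face_step submap) (half_edges submap \<times> UNIV)"
  by (rule eq_card_imp_inj_on[OF finite_states]) (simp only: face_step_states)

text \<open>The backward implication is essential: a path in the graph may run against the direction
  in which the orbit is traced.\<close>

lemma orbit_face_step_closed:
  assumes "x \<in> half_edges submap \<times> UNIV"
  shows "x \<in> orbit (face_step submap) x"
    "y \<in> half_edges submap \<times> UNIV \<Longrightarrow>
      face_step submap y \<in> orbit (face_step submap) x \<longleftrightarrow> y \<in> orbit (face_step submap) x"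
proof -
  have step: "\<And>y. y \<in> half_edges submap \<times> UNIV \<Longrightarrow> face_step submap y \<in> half_edges submap \<times> UNIV"
    using face_step_states by blast
  show self: "x \<in> orbit (face_step submap) x"
    by (rule finite_inj_in_orbit[OF finite_states assms step inj_face_step])
  show "face_step submap y \<in> orbit (face_step submap) x \<longleftrightarrow> y \<in> orbit (face_step submap) x"
    if y: "y \<in> half_edges submap \<times> UNIV"
  proof
    assume "face_step submap y \<in> orbit (face_step submap) x"
    then obtain z where z: "z \<in> orbit (face_step submap) x" "face_step submap y = face_step submap z"
      using self by cases auto
    have "orbit (face_step submap) x \<subseteq> half_edges submap \<times> UNIV"
      using assms step by (rule orbit_subset)
    then have "y = z" using inj_onD[OF inj_face_step z(2) y] z(1) by blast
    then show "y \<in> orbit (face_step submap) x" using z(1) by simp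
  qed (rule orbit.step)
qed

text \<open>The corners at white vertices record the vertex set of a component and those at colored
  vertices its edge set, so both can be read back.\<close>

definition face_of :: "'a set \<times> 'b set \<Rightarrow> (((nat \<times> 'a set) \<times> edge_end) \<times> ((nat \<times> 'a set) \<times> edge_end)) set"
  where "face_of K = vertex_corner ` fst K \<union> edge_corner ` snd K"

lemma component_closed:
  assumes "v \<in> vertices"
  shows "fst (bicolored_component X i j v) \<subseteq> vertices"
    "v \<in> fst (bicolored_component X i j v)"
    "u \<in> fst (bicolored_component X i j v) \<Longrightarrow> c \<in> {i, j} \<Longrightarrow>
      opposite c u \<in> fst (bicolored_component X i j v) \<and> edge_at c u \<in> snd (bicolored_component X i j v)"
proof -
  let ?K = "fst (bicolored_component X i j v)"
  have K: "?K = (bicolored_adj X i j)\<^sup>* `` {v}" by (simp add: bicolored_component_def Let_def)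
  show sub: "?K \<subseteq> vertices"
  proof
    fix u assume "u \<in> ?K"
    then have "(v, u) \<in> (bicolored_adj X i j)\<^sup>*" by (simp add: K)
    then show "u \<in> vertices"
    proof induction
      case (step u w)
      then obtain c where "c \<in> {i, j}" "w = opposite c u" using bicolored_adj_iff by blast
      then show ?case using opposite(1) step.IH by blast
    qed (rule assms)
  qed
  show "v \<in> ?K" by (simp add: K)
  assume u: "u \<in> ?K" and c: "c \<in> {i, j}"
  then have uv: "u \<in> vertices" using sub by blast
  then have "(u, opposite c u) \<in> bicolored_adj X i j" using c bicolored_adj_iff by blast
  then have o: "opposite c u \<in> ?K" using u by (simp add: K rtrancl.rtrancl_into_rtrancl)
  note e = edge_at[OF uv c]
  have "black_end X (edge_at c u) \<in> ?K \<and> white_end X (edge_at c u) \<in> ?K"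
    using u o e uv by (cases "u \<in> blacks X") (auto simp: opposite_def)
  then have "edge_at c u \<in> snd (bicolored_component X i j v)"
    using e c by (auto simp: bicolored_component_def Let_def bicolored_edges_def)
  then show "opposite c u \<in> ?K \<and> edge_at c u \<in> snd (bicolored_component X i j v)" using o by simp
qed

lemma snd_component:
  "e \<in> snd (bicolored_component X i j v) \<Longrightarrow>
    e \<in> edges X \<and> color X e \<in> {i, j} \<and> black_end X e \<in> fst (bicolored_component X i j v)"
  by (auto simp: bicolored_component_def Let_def bicolored_edges_def)

text \<open>The result is the same for both colors and for either kind of state, so it covers the
  two directions of tracing. An orbit contains one of the two arrivals at each vertex of the
  component, and this is enough to pass all its corners.\<close>

lemma face_eq_face_of_component:
  assumes v: "v \<in> vertices" and c: "c \<in> {i, j}" and x: "x = departure c v \<or> x = arrival c v"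
  shows "corner ` orbit (face_step submap) x = face_of (bicolored_component X i j v)"
proof
  let ?O = "orbit (face_step submap) x"
  let ?K = "fst (bicolored_component X i j v)" and ?E = "snd (bicolored_component X i j v)"
  note K = component_closed[OF v]
  have x_in: "x \<in> half_edges submap \<times> UNIV" using x departure_in[OF v c] arrival_in[OF v c] by auto
  have step_dep: "arrival d (opposite d u) \<in> ?O \<longleftrightarrow> departure d u \<in> ?O"
    if "u \<in> vertices" "d \<in> {i, j}" for u d
    using orbit_face_step_closed(2)[OF x_in departure_in[OF that]] face_step_departure(1)[OF that]
    by simp
  have step_arr: "departure (other_color d) u \<in> ?O \<longleftrightarrow> arrival d u \<in> ?O"
    if "u \<in> vertices" "d \<in> {i, j}" for u d
    using orbit_face_step_closed(2)[OF x_in arrival_in[OF that]] face_step_arrival(1)[OF that]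
    by simp
  let ?S = "{y. \<exists>u\<in>?K. \<exists>d\<in>{i, j}. y = departure d u \<or> y = arrival d u}"
  have "?O \<subseteq> ?S"
  proof (rule orbit_subset)
    show "x \<in> ?S" using x c K(2) by blast
    fix y assume "y \<in> ?S"
    then obtain u d where u: "u \<in> ?K" and d: "d \<in> {i, j}" and y: "y = departure d u \<or> y = arrival d u"
      by blast
    have uv: "u \<in> vertices" using u K(1) by blast
    from y have "face_step submap y = arrival d (opposite d u) \<or>
        face_step submap y = departure (other_color d) u"
      using face_step_departure(1)[OF uv d] face_step_arrival(1)[OF uv d] by auto
    moreover have "opposite d u \<in> ?K" using K(3)[OF u d] by simp
    ultimately show "face_step submap y \<in> ?S" using u d other_color(4)[of d] by blast
  qed
  then show "corner ` ?O \<subseteq> face_of (bicolored_component X i j v)"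
  proof (intro subsetI)
    fix z assume "z \<in> corner ` ?O" "?O \<subseteq> ?S"
    then obtain u d where u: "u \<in> ?K" and d: "d \<in> {i, j}"
      and z: "z = corner (departure d u) \<or> z = corner (arrival d u)"
      by blast
    have uv: "u \<in> vertices" using u K(1) by blast
    have "z = edge_corner (edge_at d u) \<or> z = vertex_corner u"
      using z face_step_departure(2)[OF uv d] face_step_arrival(2)[OF uv d] by simp
    then show "z \<in> face_of (bicolored_component X i j v)"
      using u K(3)[OF u d] unfolding face_of_def by blast
  qed
  have visited: "\<exists>d\<in>{i, j}. arrival d u \<in> ?O" if "(v, u) \<in> (bicolored_adj X i j)\<^sup>*" for u
    using that
  proof induction
    case base
    have "x \<in> ?O" by (rule orbit_face_step_closed(1)[OF x_in])
    \<comment> \<open>If \<open>x\<close> is a departure, its predecessor is the arrival along the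
      other color.\<close>
    then show ?case using x step_arr[OF v other_color(4), of c] c other_color(3)[OF c] other_color(4)[of c] by metis
  next
    case (step u w)
    then obtain d e where d: "d \<in> {i, j}" "arrival d u \<in> ?O"
      and u: "u \<in> vertices" and e: "e \<in> {i, j}" "w = opposite e u"
      using bicolored_adj_iff by blast
    have w: "w \<in> vertices" "opposite e w = u" using opposite[OF u e(1)] e(2) by auto
    \<comment> \<open>If \<open>e = d\<close>, the path goes back over the edge along which the
      orbit came, and the orbit is followed backwards to \<open>w\<close>; otherwise the orbit
      itself continues to \<open>w\<close>.\<close>
    show ?case
    proof (cases "e = d")
      case True
      then have "departure e w \<in> ?O" using step_dep[OF w(1) e(1)] w(2) d(2) by simp
      then have "arrival (other_color e) w \<in> ?O"
        using step_arr[OF w(1) other_color(4)[of e]] other_color(3)[OF e(1)] by simp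
      then show ?thesis using other_color(4) by blast
    next
      case False
      then have "e = other_color d" using d(1) e(1) by (intro other_color_eq)
      then have "departure e u \<in> ?O" using step_arr[OF u d(1)] d(2) by simp
      then have "arrival e w \<in> ?O" using step_dep[OF u e(1)] e(2) by simp
      then show ?thesis using e(1) by blast
    qed
  qed
  have visited': "\<exists>d\<in>{i, j}. arrival d u \<in> ?O" if "u \<in> ?K" for u
    using visited that by (simp add: bicolored_component_def Let_def)
  show "face_of (bicolored_component X i j v) \<subseteq> corner ` ?O"
    unfolding face_of_def
  proof (intro Un_least subsetI)
    fix z assume "z \<in> vertex_corner ` ?K"
    then obtain u where u: "u \<in> ?K" "z = vertex_corner u" by blast
    obtain d where d: "d \<in> {i, j}" "arrival d u \<in> ?O" using visited'[OF u(1)] by blast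
    have "z = corner (arrival d u)" using face_step_arrival(2)[OF _ d(1)] u K(1) by auto
    then show "z \<in> corner ` ?O" using d(2) by blast
  next
    fix z assume "z \<in> edge_corner ` ?E"
    then obtain e where e: "e \<in> ?E" "z = edge_corner e" by blast
    let ?c = "color X e" and ?u = "black_end X e"
    have u: "?u \<in> ?K" "?c \<in> {i, j}" "edge_at ?c ?u = e"
      using snd_component[OF e(1)] edge_at_eq(1) by auto
    have uv: "?u \<in> vertices" using u K(1) by blast
    note o = opposite[OF uv u(2)]
    obtain d where d: "d \<in> {i, j}" "arrival d ?u \<in> ?O" using visited'[OF u(1)] by blast
    \<comment> \<open>Either the orbit came along \<open>e\<close> and passed its corner on leaving
      the white end, or it leaves the black end along \<open>e\<close> next.\<close>
    show "z \<in> corner ` ?O"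
    proof (cases "?c = d")
      case True
      then have "departure ?c (opposite ?c ?u) \<in> ?O"
        using step_dep[OF o(1) u(2)] o(5) d(2) by simp
      moreover have "corner (departure ?c (opposite ?c ?u)) = z"
        using face_step_departure(2)[OF o(1) u(2)] o(4) u(3) e(2) by simp
      ultimately show ?thesis by blast
    next
      case False
      then have "?c = other_color d" using d(1) u(2) by (intro other_color_eq)
      then have "departure ?c ?u \<in> ?O" using step_arr[OF uv d(1)] d(2) by simp
      moreover have "corner (departure ?c ?u) = z"
        using face_step_departure(2)[OF uv u(2)] u(3) e(2) by simp
      ultimately show ?thesis by blast
    qed
  qed
qed

lemma map_faces_eq: "map_faces submap = face_of ` bicolored_cycles X i j"
proof
  show "map_faces submap \<subseteq> face_of ` bicolored_cycles X i j"
  proof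
    fix F assume "F \<in> map_faces submap"
    then obtain h s where h: "h \<in> half_edges submap"
      and F: "F = corner ` orbit (face_step submap) (h, s)"
      unfolding map_faces_def by blast
    obtain c v where c: "c \<in> {i, j}" and v: "v \<in> vertices"
      and st: "(h, s) = departure c v \<or> (h, s) = arrival c v"
      using state_cases[OF h] .
    show "F \<in> face_of ` bicolored_cycles X i j"
      unfolding F face_eq_face_of_component[OF v c st] bicolored_cycles_def using v by blast
  qed
  show "face_of ` bicolored_cycles X i j \<subseteq> map_faces submap"
  proof
    fix F assume "F \<in> face_of ` bicolored_cycles X i j"
    then obtain v where v: "v \<in> vertices" and F: "F = face_of (bicolored_component X i j v)"
      unfolding bicolored_cycles_def by blast
    \<comment> \<open>Any state at \<open>v\<close> would do, since all of them give the same set of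
      corners.\<close>
    obtain h s where hs: "departure i v = (h, s)" by (cases "departure i v")
    have "h \<in> half_edges submap" using departure_in[OF v, of i] hs by simp
    moreover have "F = corner ` orbit (face_step submap) (h, s)"
      using face_eq_face_of_component[OF v, of i "(h, s)"] hs F by simp
    ultimately show "F \<in> map_faces submap" unfolding map_faces_def by blast
  qed
qed

text \<open>As \<open>i\<close> and \<open>j\<close> differ, the order in which they occur in the
  corner tells the color of the vertex; its pair does the rest.\<close>

lemma inj_vertex_corner: "inj_on vertex_corner vertices"
proof (rule inj_onI)
  fix u v assume uv: "u \<in> vertices" "v \<in> vertices" "vertex_corner u = vertex_corner v"
  then have "u \<in> blacks X \<longleftrightarrow> v \<in> blacks X" "pair_of X u = pair_of X v"
    using less by (simp_all add: vertex_corner_def split: if_split_asm)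
  then show "u = v" by (rule vertex_eqI[OF uv(1,2)])
qed

lemma inj_edge_corner: "inj_on edge_corner (edges X)"
  by (rule inj_onI, rule inj_onD[OF inj_corner_of]) (auto simp: edge_corner_def prod_eq_iff)

lemma vertex_edge_corner_disjoint: "range vertex_corner \<inter> range edge_corner = {}"
  by (auto simp: vertex_corner_def edge_corner_def)

lemma component_subset:
  assumes "K \<in> bicolored_cycles X i j"
  shows "fst K \<subseteq> vertices" "snd K \<subseteq> edges X"
proof -
  obtain v where v: "v \<in> vertices" "K = bicolored_component X i j v"
    using assms unfolding bicolored_cycles_def by blast
  show "fst K \<subseteq> vertices" using component_closed(1)[OF v(1)] v(2) by simp
  show "snd K \<subseteq> edges X" using snd_component v(2) by blast
qed

lemma bij_face_of: "bij_betw face_of (bicolored_cycles X i j) (map_faces submap)"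
proof (rule bij_betw_imageI[OF _ map_faces_eq[symmetric]], rule inj_onI)
  fix K L assume K: "K \<in> bicolored_cycles X i j" and L: "L \<in> bicolored_cycles X i j"
    and eq: "face_of K = face_of L"
  \<comment> \<open>The two kinds of corners are disjoint, so removing one kind from a face leaves
    exactly the other.\<close>
  have "vertex_corner ` fst K = face_of K - range edge_corner" for K
    using vertex_edge_corner_disjoint unfolding face_of_def by blast
  moreover have "edge_corner ` snd K = face_of K - range vertex_corner" for K
    using vertex_edge_corner_disjoint unfolding face_of_def by blast
  ultimately have "vertex_corner ` fst K = vertex_corner ` fst L" "edge_corner ` snd K = edge_corner ` snd L"
    using eq by simp_all
  then have "fst K = fst L" "snd K = snd L"
    using inj_on_image_eq_iff[OF inj_vertex_corner component_subset(1)[OF K] component_subset(1)[OF L]]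
      inj_on_image_eq_iff[OF inj_edge_corner component_subset(2)[OF K] component_subset(2)[OF L]]
    by simp_all
  then show "K = L" by (rule prod_eqI)
qed

text \<open>This ties the abstract bijection to the correspondence between edges of the graph and
  corners at colored vertices: a face goes through the corners of the edges of its cycle.\<close>

lemma colored_corners_face_of: "colored_corners (face_of K) = corner_of X ` snd K"
proof -
  have "colored_corners (vertex_corner ` V) = {}" for V :: "'a set"
    by (auto simp: colored_corners_def vertex_corner_def split: if_splits)
  moreover have "colored_corners ((\<lambda>(e, f). ((e, Colored_End), (f, Colored_End))) ` S) = S"
    for S :: "((nat \<times> 'a set) \<times> (nat \<times> 'a set)) set"
    by (auto simp: colored_corners_def)
  from this[of "corner_of X ` E" for E]
  have "colored_corners (edge_corner ` E) = corner_of X ` E" for E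
    by (simp add: edge_corner_def[abs_def] case_prod_unfold image_image)
  moreover have "colored_corners (A \<union> B) = colored_corners A \<union> colored_corners B"
    for A B :: "(((nat \<times> 'a set) \<times> edge_end) \<times> ((nat \<times> 'a set) \<times> edge_end)) set"
    by (auto simp: colored_corners_def)
  ultimately show ?thesis unfolding face_of_def by simp
qed

end

section \<open>The bijection\<close>

lemma paired_graph_classesE:
  fixes C :: "('v, 'e) paired_graph set"
  assumes "C \<in> paired_graph_classes D q"
  obtains X :: "('v, 'e) paired_graph" where "marked_paired_graph D q X"
    "C = {Y. marked_paired_graph D q Y \<and> paired_graph_iso X Y}"
  using assms unfolding paired_graph_classes_def by (auto elim!: quotientE)

lemma stacked_map_classesE:
  fixes C :: "('w, 'c, 'd) stacked_map set"
  assumes "C \<in> stacked_map_classes D q"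
  obtains \<Gamma> :: "('w, 'c, 'd) stacked_map" where "stacked_map D q \<Gamma>"
    "C = {\<Delta>. stacked_map D q \<Delta> \<and> stacked_map_iso \<Gamma> \<Delta>}"
  using assms unfolding stacked_map_classes_def by (auto elim!: quotientE)

lemma stacked_map_Psi:
  "marked_paired_graph D q X \<Longrightarrow> stacked_map D q (Psi D X)"
  by (rule paired_graph.stacked_map_Psi[OF marked_paired_graph_imp_paired_graph])

lemma stacked_map_iso_refl: "stacked_map_iso \<Gamma> \<Gamma>"
  unfolding stacked_map_iso_def by (intro exI[of _ id]) (simp add: map_prod.id)

text \<open>Through this equivalence isomorphism of graphs inherits what is needed of an equivalence
  relation from isomorphism of stacked maps.\<close>

lemma paired_graph_iso_iff:
  assumes "marked_paired_graph D q X" "marked_paired_graph D q Y"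
  shows "paired_graph_iso X Y \<longleftrightarrow> stacked_map_iso (Psi D X) (Psi D Y)"
  using paired_graph_iso_imp_stacked_map_iso_Psi[OF assms]
    stacked_map_iso_Psi_imp_paired_graph_iso[OF assms] by blast

text \<open>Independence of the representative: a class of graphs may be replaced by any one of its
  members, and \<open>X\<close> is a member by reflexivity.\<close>

lemma Psi_class_eq:
  fixes X :: "('v, 'e) paired_graph"
  assumes X: "marked_paired_graph D q X"
  shows "Psi_class D q {Y :: ('v, 'e) paired_graph. marked_paired_graph D q Y \<and> paired_graph_iso X Y} =
    {\<Gamma> :: ('w, 'c, 'd) stacked_map. stacked_map D q \<Gamma> \<and> stacked_map_iso (Psi D X) \<Gamma>}"
proof -
  have "stacked_map_iso (Psi D X) \<Gamma>"
    if "marked_paired_graph D q Y" "paired_graph_iso X Y" "stacked_map_iso (Psi D Y) \<Gamma>"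
    for Y :: "('v, 'e) paired_graph" and \<Gamma> :: "('w, 'c, 'd) stacked_map"
    using stacked_map_iso_trans[OF stacked_map_Psi[OF X]] paired_graph_iso_iff[OF X that(1)] that
    by blast
  moreover have "paired_graph_iso X X"
    unfolding paired_graph_iso_iff[OF X X] by (rule stacked_map_iso_refl)
  ultimately show ?thesis using X unfolding Psi_class_def by blast
qed

lemma bij_betw_Psi_class:
  "bij_betw (Psi_class D q :: ('v::infinite, 'e::infinite) paired_graph set \<Rightarrow>
      ('w::infinite, 'c::infinite, 'd::infinite) stacked_map set)
    (paired_graph_classes D q) (stacked_map_classes D q)"
proof (rule bij_betw_imageI)
  let ?\<Psi> = "Psi_class D q :: ('v, 'e) paired_graph set \<Rightarrow> ('w, 'c, 'd) stacked_map set"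
  \<comment> \<open>Here \<open>\<Delta>\<close> stands in for \<open>Psi D X\<close> on the target
    label types, where it can represent the class.\<close>
  have iso_iff: "stacked_map_iso (Psi D X) \<Gamma> \<longleftrightarrow> stacked_map_iso \<Delta> \<Gamma>"
    if X: "marked_paired_graph D q X" and \<Delta>: "stacked_map_iso (Psi D X) \<Delta>"
    for X :: "('v, 'e) paired_graph" and \<Gamma> \<Delta> :: "('w, 'c, 'd) stacked_map"
  proof -
    note P = stacked_map_Psi[OF X]
    have "stacked_map D q \<Delta>" using stacked_map_iso_preserves[OF P \<Delta>] .
    then show ?thesis
      using stacked_map_iso_trans[OF P \<Delta>] stacked_map_iso_trans[OF _ stacked_map_iso_sym[OF P \<Delta>]]
      by blast
  qed
  show "inj_on ?\<Psi> (paired_graph_classes D q)"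
  proof (rule inj_onI)
    fix C C' :: "('v, 'e) paired_graph set"
    assume C: "C \<in> paired_graph_classes D q" and C': "C' \<in> paired_graph_classes D q"
      and eq: "?\<Psi> C = ?\<Psi> C'"
    obtain X :: "('v, 'e) paired_graph" where X: "marked_paired_graph D q X"
      "C = {Y. marked_paired_graph D q Y \<and> paired_graph_iso X Y}"
      using C by (rule paired_graph_classesE)
    obtain X' :: "('v, 'e) paired_graph" where X': "marked_paired_graph D q X'"
      "C' = {Y. marked_paired_graph D q Y \<and> paired_graph_iso X' Y}"
      using C' by (rule paired_graph_classesE)
    note P = stacked_map_Psi[OF X(1)] and P' = stacked_map_Psi[OF X'(1)]
    \<comment> \<open>A relabelled copy makes the image class nonempty; as a common element of both
      images it links \<open>Psi D X\<close> to \<open>Psi D X'\<close>.\<close>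
    obtain \<Gamma> :: "('w, 'c, 'd) stacked_map" where \<Gamma>: "stacked_map D q \<Gamma>" "stacked_map_iso (Psi D X) \<Gamma>"
      using stacked_map_relabel[OF P] .
    have "\<Gamma> \<in> ?\<Psi> C" using \<Gamma> X(2) Psi_class_eq[OF X(1)] by blast
    then have \<Gamma>': "stacked_map_iso (Psi D X') \<Gamma>" using eq X'(2) Psi_class_eq[OF X'(1)] by blast
    have XX': "stacked_map_iso (Psi D X) (Psi D X')"
      by (rule stacked_map_iso_trans[OF P \<Gamma>(2) stacked_map_iso_sym[OF P' \<Gamma>']])
    have "paired_graph_iso X Y \<longleftrightarrow> paired_graph_iso X' Y" if Y: "marked_paired_graph D q Y"
      for Y :: "('v, 'e) paired_graph"
      unfolding paired_graph_iso_iff[OF X(1) Y] paired_graph_iso_iff[OF X'(1) Y]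
      using stacked_map_iso_trans[OF P XX'] stacked_map_iso_trans[OF P' stacked_map_iso_sym[OF P XX']]
      by blast
    then show "C = C'" unfolding X(2) X'(2) by blast
  qed
  show "?\<Psi> ` paired_graph_classes D q = stacked_map_classes D q"
  proof
    show "?\<Psi> ` paired_graph_classes D q \<subseteq> stacked_map_classes D q"
    proof
      fix S assume "S \<in> ?\<Psi> ` paired_graph_classes D q"
      then obtain C where "C \<in> paired_graph_classes D q" and S: "S = ?\<Psi> C" by blast
      then obtain X :: "('v, 'e) paired_graph" where X: "marked_paired_graph D q X"
        "C = {Y. marked_paired_graph D q Y \<and> paired_graph_iso X Y}"
        by (auto elim: paired_graph_classesE)
      obtain \<Delta> :: "('w, 'c, 'd) stacked_map" where \<Delta>: "stacked_map D q \<Delta>" "stacked_map_iso (Psi D X) \<Delta>"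
        using stacked_map_relabel[OF stacked_map_Psi[OF X(1)]] .
      have "S = {\<Gamma>. stacked_map D q \<Gamma> \<and> stacked_map_iso \<Delta> \<Gamma>}"
        unfolding S X(2) Psi_class_eq[OF X(1)] using iso_iff[OF X(1) \<Delta>(2)] by blast
      then show "S \<in> stacked_map_classes D q"
        unfolding stacked_map_classes_def quotient_def using \<Delta>(1) by blast
    qed
    show "stacked_map_classes D q \<subseteq> ?\<Psi> ` paired_graph_classes D q"
    proof
      fix S :: "('w, 'c, 'd) stacked_map set"
      assume "S \<in> stacked_map_classes D q"
      then obtain \<Delta> :: "('w, 'c, 'd) stacked_map" where \<Delta>: "stacked_map D q \<Delta>"
        and S: "S = {\<Gamma>. stacked_map D q \<Gamma> \<and> stacked_map_iso \<Delta> \<Gamma>}"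
        by (rule stacked_map_classesE)
      obtain X :: "('v, 'e) paired_graph" where X: "marked_paired_graph D q X"
        "stacked_map_iso \<Delta> (Psi D X)"
        using stacked_map_iso_Psi_exists[OF \<Delta>] .
      let ?C = "{Y :: ('v, 'e) paired_graph. marked_paired_graph D q Y \<and> paired_graph_iso X Y}"
      have "?\<Psi> ?C = S"
        unfolding S Psi_class_eq[OF X(1)]
        using iso_iff[OF X(1) stacked_map_iso_sym[OF \<Delta> X(2)]] by blast
      moreover have "?C \<in> paired_graph_classes D q"
        unfolding paired_graph_classes_def quotient_def using X(1) by blast
      ultimately show "S \<in> ?\<Psi> ` paired_graph_classes D q" by blast
    qed
  qed
qed

theorem theorem2p3p1:
  fixes D q :: nat
  assumes "D \<ge> 1"
  shows "(\<forall>X :: ('v::infinite, 'e::infinite) paired_graph.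
            marked_paired_graph D q X \<longrightarrow> stacked_map D q (Psi D X)) \<and>
         bij_betw
           (Psi_class D q ::
              ('v, 'e) paired_graph set \<Rightarrow>
              ('w::infinite, 'c::infinite, 'd::infinite) stacked_map set)
           (paired_graph_classes D q) (stacked_map_classes D q) \<and>
         (\<forall>(X :: ('v, 'e) paired_graph) i j.
            marked_paired_graph D q X \<longrightarrow> i < j \<longrightarrow> j \<le> D \<longrightarrow>
            (\<exists>\<Phi>. bij_betw \<Phi> (bicolored_cycles X i j) (map_faces (twisted_submap (Psi D X) i j)) \<and>
                 (\<forall>K\<in>bicolored_cycles X i j.
                    colored_corners (\<Phi> K) = corner_of X ` snd K)))"
proof (intro conjI allI impI)
  fix X :: "('v, 'e) paired_graph" and i j
  assume "marked_paired_graph D q X" "i < j" "j \<le> D"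
  then interpret bicolored_paired_graph D X i j
    using marked_paired_graph_imp_paired_graph
    by (simp add: bicolored_paired_graph_def bicolored_paired_graph_axioms_def)
  show "\<exists>\<Phi>. bij_betw \<Phi> (bicolored_cycles X i j) (map_faces (twisted_submap (Psi D X) i j)) \<and>
      (\<forall>K\<in>bicolored_cycles X i j. colored_corners (\<Phi> K) = corner_of X ` snd K)"
    using bij_face_of colored_corners_face_of by blast
qed (rule stacked_map_Psi bij_betw_Psi_class, assumption?)+

end
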